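(* Let $p:\mathbb{R}_+^2\to(0,\infty)$ be a polynomial given by $p(x,y)=a+bx+cy+dxy$, $x,y\in\mathbb{R}_+$, where $a,b,c,d\in\mathbb{R}$. The following statements are equivalent: (i) $\frac1p$ is a joint completely monotone function; (ii) $M:=bc-ad\ge 0$; (iii) $\big\{\frac{1}{p(m,n)}\big\}_{m,n\in\mathbb{Z}_+}$ is a joint completely monotone net; (iv) $\big\{\frac{1}{p(m,n)}\big\}_{m,n\in\mathbb{Z}_+}$ is a minimal joint completely monotone net. If (ii) holds, then for every positive integer $l$, $\big\{\frac{1}{p(m,n)^l}\big\}_{m,n\in\mathbb{Z}_+}$ is a minimal joint completely monotone net with the representing measure (in the variables $(s,t)\in[0,1]^2$) given by $$\begin{cases}\dfrac{s^{\frac cd-1}t^{\frac bd-1}}{d\,(l-1)!}\left(\dfrac{\log t\,\log s}{M}\right)^{\frac{l-1}{2}} I_{l-1}\!\left(\dfrac2d\sqrt{M\log s\,\log t}\right)ds\,dt, & M>0,\ d\ne 0,\\[2ex] \dfrac{s^{\frac cd-1}t^{\frac bd-1}}{d^l\,(l-1)!}\,\dfrac{(\log t\,\log s)^{l-1}}{(l-1)!}\,ds\,dt, & M=0,\ d\neq 0,\\[2ex] \dfrac{(-1)^{l-1}}{b^l\,(l-1)!}(\log s)^{l-1}s^{\frac ab-1}\,d\delta_{s^{c/b}}(t)\,ds, & b\ne 0,\ d=0.\end{cases}$$ Moreover, if $d\ne 0$, $M\ge 0$ and $\omega_{M,l}$ denotes the weight function (density with respect to $ds\,dt$, as displayed above)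 of the representing measure of $\big\{\frac{1}{p(m,n)^l}\big\}_{m,n\in\mathbb{Z}_+}$, then $$\lim_{M\to 0,\ M>0}\omega_{M,l}=\omega_{0,l},\qquad l\ge 1,$$ where $\omega_{M,l}(s,t)$ is regarded as a function of $M$ with $b,c,d$ fixed and the limit is pointwise in $(s,t)\in(0,1)^2$.
   Context: $\mathbb{Z}_+$ is the set of nonnegative integers and $\mathbb{R}_+$ the set of nonnegative reals. An infinitely differentiable function $f:\mathbb{R}_+^2\to(0,\infty)$ is joint completely monotone if $(-1)^{i+j}(\partial_1^i\partial_2^j f)(x,y)\ge 0$ for all $i,j\in\mathbb{Z}_+$, $x,y\in\mathbb{R}_+$. For a real sequence $\{u_k\}_{k\in\mathbb{Z}_+}$ put $\triangle u_k=u_{k+1}-u_k$; it is completely monotone if $(-1)^j\triangle^j u_k\ge 0$ for all $j,k\in\mathbb{Z}_+$. For a real net $\{u_{m,n}\}_{m,n\in\mathbb{Z}_+}$ put $\triangle_1u_{m,n}=u_{m+1,n}-u_{m,n}$, $\triangle_2u_{m,n}=u_{m,n+1}-u_{m,n}$. The net is joint completely monotone if $(-1)^{i+j}\triangle_1^i\triangle_2^j u_{m,n}\ge 0$ for all $i,j,m,n\in\mathbb{Z}_+$. It is minimal if for every $\epsilon>0$ neither of the sequences $\{u_{k,0}-\epsilon\mathbf{1}_{\{0\}}(k)\}_k$, $\{u_{0,k}-\epsilon\mathbf{1}_{\{0\}}(k)\}_k$ is completely monotone. A net is joint completely monotone if and only if there is a finite positive regular Borel measure $\mu$ on $[0,1]^2$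 with $u_{m,n}=\int_{[0,1]^2}s^mt^n\,\mu(d(s,t))$ for all $m,n\in\mathbb{Z}_+$; this $\mu$ is unique and is called the representing measure of the net. $\delta_x$ is the Dirac measure at $x$. $I_\nu(z)=(z/2)^\nu\sum_{k=0}^\infty (z^2/4)^k\frac{1}{k!\,\Gamma(\nu+k+1)}$ is the modified Bessel function of the first kind of order $\nu$. *)

theory Defs
  imports "HOL-Analysis.Analysis"
begin

(* A function on the closed quadrant [0,oo)^2 is a curried function whose values outside the
   quadrant are ignored; derivatives at boundary points are one-sided (taken within [0,oo)). *)

definition partial1 :: "(real \<Rightarrow> real \<Rightarrow> real) \<Rightarrow> real \<Rightarrow> real \<Rightarrow> real" where
  "partial1 f = (\<lambda>x y. vector_derivative (\<lambda>t. f t y) (at x within {0..}))"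

definition partial2 :: "(real \<Rightarrow> real \<Rightarrow> real) \<Rightarrow> real \<Rightarrow> real \<Rightarrow> real" where
  "partial2 f = (\<lambda>x y. vector_derivative (\<lambda>t. f x t) (at y within {0..}))"

primrec Ck_quadrant :: "nat \<Rightarrow> (real \<Rightarrow> real \<Rightarrow> real) \<Rightarrow> bool" where
  "Ck_quadrant 0 f \<longleftrightarrow> continuous_on ({0..} \<times> {0..}) (\<lambda>(x, y). f x y)"
| "Ck_quadrant (Suc k) f \<longleftrightarrow>
     continuous_on ({0..} \<times> {0..}) (\<lambda>(x, y). f x y) \<and>
     (\<forall>x\<ge>0. \<forall>y\<ge>0. (\<lambda>t. f t y) differentiable (at x within {0..}) \<and>
                   (\<lambda>t. f x t) differentiable (at y within {0..})) \<and>
     Ck_quadrant k (partial1 f) \<and> Ck_quadrant k (partial2 f)"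

definition smooth_quadrant :: "(real \<Rightarrow> real \<Rightarrow> real) \<Rightarrow> bool" where
  "smooth_quadrant f \<longleftrightarrow> (\<forall>k. Ck_quadrant k f)"

definition joint_cm_function :: "(real \<Rightarrow> real \<Rightarrow> real) \<Rightarrow> bool" where
  "joint_cm_function f \<longleftrightarrow>
     smooth_quadrant f \<and>
     (\<forall>x\<ge>0. \<forall>y\<ge>0. f x y > 0) \<and>
     (\<forall>i j. \<forall>x\<ge>0. \<forall>y\<ge>0. (-1) ^ (i + j) * (partial1 ^^ i) ((partial2 ^^ j) f) x y \<ge> 0)"

definition fdiff :: "(nat \<Rightarrow> real) \<Rightarrow> nat \<Rightarrow> real" where
  "fdiff u = (\<lambda>k. u (k + 1) - u k)"

definition cm_sequence :: "(nat \<Rightarrow> real) \<Rightarrow> bool" where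
  "cm_sequence u \<longleftrightarrow> (\<forall>j k. (-1) ^ j * (fdiff ^^ j) u k \<ge> 0)"

definition fdiff1 :: "(nat \<Rightarrow> nat \<Rightarrow> real) \<Rightarrow> nat \<Rightarrow> nat \<Rightarrow> real" where
  "fdiff1 u = (\<lambda>m n. u (m + 1) n - u m n)"

definition fdiff2 :: "(nat \<Rightarrow> nat \<Rightarrow> real) \<Rightarrow> nat \<Rightarrow> nat \<Rightarrow> real" where
  "fdiff2 u = (\<lambda>m n. u m (n + 1) - u m n)"

definition joint_cm_net :: "(nat \<Rightarrow> nat \<Rightarrow> real) \<Rightarrow> bool" where
  "joint_cm_net u \<longleftrightarrow>
     (\<forall>i j m n. (-1) ^ (i + j) * (fdiff1 ^^ i) ((fdiff2 ^^ j) u) m n \<ge> 0)"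

definition minimal_net :: "(nat \<Rightarrow> nat \<Rightarrow> real) \<Rightarrow> bool" where
  "minimal_net u \<longleftrightarrow>
     (\<forall>\<epsilon>>0. \<not> cm_sequence (\<lambda>k. u k 0 - \<epsilon> * indicator {0} k) \<and>
            \<not> cm_sequence (\<lambda>k. u 0 k - \<epsilon> * indicator {0} k))"

abbreviation unit_square :: "(real \<times> real) set" where
  "unit_square \<equiv> {0..1} \<times> {0..1}"

(* Regularity need not be required: every finite Borel measure on the compact
   metric space [0,1]^2 is regular. *)
definition is_representing_measure ::
    "(nat \<Rightarrow> nat \<Rightarrow> real) \<Rightarrow> (real \<times> real) measure \<Rightarrow> bool" where
  "is_representing_measure u \<mu> \<longleftrightarrow>
     finite_measure \<mu> \<and>
     sets \<mu> = sets (restrict_space borel unit_square) \<and>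
     (\<forall>m n. u m n = (\<integral>(s, t). s ^ m * t ^ n \<partial>\<mu>))"

(* For real order nu and z >= 0.  The first factor is (z/2)^nu with the convention z^0 = 1;
   it is split off because 0 powr 0 = 0. *)
definition bessel_I :: "real \<Rightarrow> real \<Rightarrow> real" where
  "bessel_I \<nu> z = (if \<nu> = 0 then 1 else (z / 2) powr \<nu>) *
     (\<Sum>k. (z\<^sup>2 / 4) ^ k * (1 / (fact k * Gamma (\<nu> + real k + 1))))"

(* The density omega_{M,l}(s,t), with M as a parameter of its own so that b, c, d can be
   kept fixed while M varies.  Only M >= 0, d > 0 and l >= 1 are meaningful.  Where s or t is
   0 or 1 (a Lebesgue null set), the conventions ln 0 = 0 and 0 powr x = 0 apply. *)
definition weight :: "real \<Rightarrow> real \<Rightarrow> real \<Rightarrow> real \<Rightarrow> nat \<Rightarrow> real \<Rightarrow> real \<Rightarrow> real" where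
  "weight b c d M l s t =
     (if M > 0 then
        s powr (c / d - 1) * t powr (b / d - 1) / (d * fact (l - 1))
          * (ln t * ln s / M) powr (real (l - 1) / 2)
          * bessel_I (real (l - 1)) (2 / d * sqrt (M * ln s * ln t))
      else
        s powr (c / d - 1) * t powr (b / d - 1) / (d ^ l * fact (l - 1))
          * ((ln t * ln s) ^ (l - 1) / fact (l - 1)))"

definition weighted_measure ::
    "real \<Rightarrow> real \<Rightarrow> real \<Rightarrow> real \<Rightarrow> nat \<Rightarrow> (real \<times> real) measure" where
  "weighted_measure b c d M l =
     density (restrict_space lborel unit_square) (\<lambda>(s, t). ennreal (weight b c d M l s t))"

(* The measure w(s) d delta_{s^(c/b)}(t) ds is the image of w(s) ds on [0,1] under
   s |-> (s, s^(c/b)). *)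
definition curve_measure ::
    "real \<Rightarrow> real \<Rightarrow> real \<Rightarrow> nat \<Rightarrow> (real \<times> real) measure" where
  "curve_measure a b c l =
     distr
       (density (restrict_space lborel {0..1})
          (\<lambda>s. ennreal ((-1) ^ (l - 1) / (b ^ l * fact (l - 1))
                          * ln s ^ (l - 1) * s powr (a / b - 1))))
       (restrict_space borel unit_square)
       (\<lambda>s. (s, s powr (c / b)))"

end

theory Submission
  imports Defs "HOL-Real_Asymp.Real_Asymp"
begin

text \<open>
  Write \<open>w = 1/p\<close>, \<open>u = (b + d y)/p\<close>, \<open>v = (c + d x)/p\<close>. Then \<open>-\<partial>\<^sub>1\<close> sends \<open>w, u, v\<close> to
  \<open>u w\<close>, \<open>u\<^sup>2\<close>, \<open>M w\<^sup>2\<close> and \<open>-\<partial>\<^sub>2\<close> sends them to \<open>v w\<close>, \<open>M w\<^sup>2\<close>, \<open>v\<^sup>2\<close>. If \<open>M \<ge> 0\<close>, the polynomials in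
  \<open>u, v, w\<close> with nonnegative coefficients are therefore stable under both operators, so \<open>1/p\<close>
  is joint completely monotone. If \<open>M < 0\<close>, then \<open>-\<partial>\<^sub>2\<close> applied to \<open>(-\<partial>\<^sub>1)\<^sup>i (1/p)\<close> is a positive
  multiple of \<open>d p + (i + 1) M\<close>, negative for large \<open>i\<close>; for the net, the corresponding
  ratio of \<open>i\<close>-th differences diverges like a harmonic product.

  For \<open>d > 0\<close> write \<open>p = d X Y - M/d\<close> with \<open>X = x + c/d\<close>, \<open>Y = y + b/d\<close>. Expanding \<open>p\<close> to the power \<open>-l\<close>
  by the binomial series in \<open>M/(d\<^sup>2 X Y)\<close> and writing each power of \<open>1/X\<close> and \<open>1/Y\<close> as the integral of
  a power of \<open>s\<close> or \<open>t\<close> times a power of its logarithm gives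
  the Bessel density. A moment net of a measure without mass on the axes is minimal, because
  the \<open>j\<close>-th moments of \<open>1 - s\<close> and \<open>1 - t\<close> tend to 0.
\<close>

section \<open>Partial derivatives of reciprocals of bilinear polynomials\<close>

text \<open>An inductive closure rather than explicit polynomials in \<open>u\<close>,
  \<open>v\<close>, \<open>w\<close>: nonnegativity, continuity and stability under the two
  derivatives then each follow by rule induction.\<close>

inductive_set signed_class :: "real \<Rightarrow> real \<Rightarrow> real \<Rightarrow> real \<Rightarrow> (real \<Rightarrow> real \<Rightarrow> real) set"
  for a b c d where
  const: "r \<ge> 0 \<Longrightarrow> (\<lambda>x y. r) \<in> signed_class a b c d"
| recip: "(\<lambda>x y. 1 / (a + b * x + c * y + d * x * y)) \<in> signed_class a b c d"
| dlog1: "(\<lambda>x y. (b + d * y) / (a + b * x + c * y + d * x * y)) \<in> signed_class a b c d"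
| dlog2: "(\<lambda>x y. (c + d * x) / (a + b * x + c * y + d * x * y)) \<in> signed_class a b c d"
| add: "f \<in> signed_class a b c d \<Longrightarrow> g \<in> signed_class a b c d \<Longrightarrow> (\<lambda>x y. f x y + g x y) \<in> signed_class a b c d"
| mult: "f \<in> signed_class a b c d \<Longrightarrow> g \<in> signed_class a b c d \<Longrightarrow> (\<lambda>x y. f x y * g x y) \<in> signed_class a b c d"

text \<open>The minus signs belong to the definition so that \<open>g\<close> and \<open>h\<close>
  can again be nonnegative functions. The one-sided filters match \<open>partial1\<close> and
  \<open>partial2\<close> on the boundary of the quadrant.\<close>

definition neg_derivs :: "(real \<Rightarrow> real \<Rightarrow> real) \<Rightarrow> (real \<Rightarrow> real \<Rightarrow> real) \<Rightarrow> (real \<Rightarrow> real \<Rightarrow> real) \<Rightarrow> bool" where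
  "neg_derivs f g h \<longleftrightarrow> (\<forall>x\<ge>0. \<forall>y\<ge>0.
     ((\<lambda>t. f t y) has_real_derivative - g x y) (at x within {0..}) \<and>
     ((\<lambda>t. f x t) has_real_derivative - h x y) (at y within {0..}))"

text \<open>The quotient rule with the result \<open>R\<close> prescribed and denominators cleared,
  so that each use leaves only a short algebraic identity to check.\<close>

lemma quotient_deriv:
  assumes "(N has_real_derivative E) (at x within S)" "(P has_real_derivative D) (at x within S)"
    and "N x = n" "P x = p" "p \<noteq> 0" "n * D - E * p = R * (p * p)"
  shows "((\<lambda>t. N t / P t) has_real_derivative - R) (at x within S)"
proof -
  have "((\<lambda>t. N t / P t) has_real_derivative (E * p - n * D) / (p * p)) (at x within S)"
    using DERIV_divide[OF assms(1,2)] assms(3-5) by simp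
  also have "E * p - n * D = - R * (p * p)" using assms(6) by simp
  finally show ?thesis using assms(5) by simp
qed

lemma neg_derivs_add:
  assumes "neg_derivs f f1 f2" "neg_derivs g g1 g2"
  shows "neg_derivs (\<lambda>x y. f x y + g x y) (\<lambda>x y. f1 x y + g1 x y) (\<lambda>x y. f2 x y + g2 x y)"
  unfolding neg_derivs_def
proof (intro allI impI conjI)
  fix x y :: real assume xy: "x \<ge> 0" "y \<ge> 0"
  show "((\<lambda>t. f t y + g t y) has_real_derivative - (f1 x y + g1 x y)) (at x within {0..})"
    by (rule DERIV_cong[OF DERIV_add]) (use xy assms in \<open>auto simp: neg_derivs_def\<close>)
  show "((\<lambda>t. f x t + g x t) has_real_derivative - (f2 x y + g2 x y)) (at y within {0..})"
    by (rule DERIV_cong[OF DERIV_add]) (use xy assms in \<open>auto simp: neg_derivs_def\<close>)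
qed

lemma neg_derivs_mult:
  assumes "neg_derivs f f1 f2" "neg_derivs g g1 g2"
  shows "neg_derivs (\<lambda>x y. f x y * g x y) (\<lambda>x y. f1 x y * g x y + f x y * g1 x y)
    (\<lambda>x y. f2 x y * g x y + f x y * g2 x y)"
  unfolding neg_derivs_def
proof (intro allI impI conjI)
  fix x y :: real assume xy: "x \<ge> 0" "y \<ge> 0"
  show "((\<lambda>t. f t y * g t y) has_real_derivative - (f1 x y * g x y + f x y * g1 x y)) (at x within {0..})"
    by (rule DERIV_cong[OF DERIV_mult[where Da = "- f1 x y" and Db = "- g1 x y"]])
      (use xy assms in \<open>auto simp: neg_derivs_def\<close>)
  show "((\<lambda>t. f x t * g x t) has_real_derivative - (f2 x y * g x y + f x y * g2 x y)) (at y within {0..})"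
    by (rule DERIV_cong[OF DERIV_mult[where Da = "- f2 x y" and Db = "- g2 x y"]])
      (use xy assms in \<open>auto simp: neg_derivs_def\<close>)
qed

lemma DERIV_inverse_power:
  fixes Q :: "real \<Rightarrow> real"
  assumes "(Q has_real_derivative D) (at x within S)" "Q x \<noteq> 0"
  shows "((\<lambda>t. 1 / Q t ^ k) has_real_derivative - (real k * D / Q x ^ (k + 1))) (at x within S)"
proof (rule DERIV_cong[OF DERIV_divide[OF DERIV_const DERIV_power[OF assms(1)]]])
  have "w \<noteq> 0 \<Longrightarrow> (0 * w ^ k - 1 * (real k * (D * w ^ (k - Suc 0)))) / (w ^ k * w ^ k)
    = - (real k * D / w ^ (k + 1))" for w :: real
    \<comment> \<open>The case split deals with the truncated \<open>k - Suc 0\<close> at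
      \<open>k = 0\<close>.\<close>
    by (cases k) (simp_all add: field_simps)
  from this[OF assms(2)] show "(0 * Q x ^ k - 1 * (real k * (D * Q x ^ (k - Suc 0)))) / (Q x ^ k * Q x ^ k)
    = - (real k * D / Q x ^ (k + 1))" .
qed (use assms in auto)

text \<open>\<open>vector_derivative\<close> is a choice operator, so its value is known only once
  the derivative is unique. Agreement with \<open>g\<close> is required on the half-line only, since
  values outside the quadrant are arbitrary.\<close>

lemma vector_derivative_quadrant:
  assumes "(g has_real_derivative D) (at x within {0..})" "x \<ge> 0"
    and "\<And>t. t \<ge> 0 \<Longrightarrow> f t = g t"
  shows "f differentiable (at x within {0..})" "vector_derivative f (at x within {0..}) = D"
proof -
  have "(f has_real_derivative D) (at x within {0..})"
    by (rule has_field_derivative_transform_within[OF assms(1), of 1]) (use assms in auto)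
  then have v: "(f has_vector_derivative D) (at x within {0..})"
    by (simp add: has_real_derivative_iff_has_vector_derivative)
  show "f differentiable (at x within {0..})" using v by (rule differentiableI_vector)
  show "vector_derivative f (at x within {0..}) = D"
  proof (rule vector_derivative_within[OF _ v])
    \<comment> \<open>Uniqueness needs a nontrivial filter; points to the right of \<open>x\<close>
      provide it even at the boundary point 0.\<close>
    have "at_right x \<le> at x within {0..}" by (rule at_le) (use assms(2) in auto)
    then show "at x within {0..} \<noteq> bot"
      using trivial_limit_at_right_real[of x] bot.extremum_uniqueI by metis
  qed
qed

section \<open>Signs of the coefficients, and joint complete monotonicity of \<open>1/p\<close> in
  terms of \<open>M\<close>\<close>

locale bilinear_pos =
  fixes a b c d :: real
  assumes pos: "\<And>x y. x \<ge> 0 \<Longrightarrow> y \<ge> 0 \<Longrightarrow> a + b * x + c * y + d * x * y > 0"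
begin

lemma a_pos: "a > 0" using pos[of 0 0] by simp

lemma b_nonneg: "b \<ge> 0"
proof (rule ccontr)
  assume "\<not> b \<ge> 0"
  \<comment> \<open>With \<open>b < 0\<close> the polynomial would vanish on the positive
    \<open>x\<close>-axis, at \<open>- a / b\<close>.\<close>
  then show False using pos[of "- a / b" 0] a_pos by (auto simp: field_simps)
qed

lemma c_nonneg: "c \<ge> 0"
proof (rule ccontr)
  assume "\<not> c \<ge> 0"
  then show False using pos[of 0 "- a / c"] a_pos by (auto simp: field_simps)
qed

lemma d_nonneg: "d \<ge> 0"
proof (rule ccontr)
  assume d: "\<not> d \<ge> 0"
  \<comment> \<open>On the diagonal \<open>x = y\<close> a negative \<open>d\<close> dominates at
    infinity.\<close>
  have "eventually (\<lambda>x::real. a + b * x + c * x + d * x * x < 0) at_top"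
    using d by real_asymp
  then have "eventually (\<lambda>x::real. a + b * x + c * x + d * x * x < 0 \<and> x \<ge> 0) at_top"
    using eventually_ge_at_top[of 0] by eventually_elim auto
  then obtain x where "a + b * x + c * x + d * x * x < 0" "x \<ge> 0"
    using eventually_happens trivial_limit_at_top_linorder by blast
  then show False using pos[of x x] by auto
qed

lemma signed_class_nonneg:
  assumes "f \<in> signed_class a b c d" "x \<ge> 0" "y \<ge> 0"
  shows "f x y \<ge> 0"
  using assms
proof induction
qed (use pos[of x y] b_nonneg c_nonneg d_nonneg in \<open>auto intro!: divide_nonneg_pos add_nonneg_nonneg\<close>)

lemma signed_class_continuous:
  assumes "f \<in> signed_class a b c d"
  shows "continuous_on ({0..} \<times> {0..}) (\<lambda>z. f (fst z) (snd z))"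
proof -
  have *: "a + b * fst z + c * snd z + d * fst z * snd z \<noteq> 0" if "z \<in> {0..} \<times> {0..}" for z :: "real \<times> real"
    using that pos[of "fst z" "snd z"] by (auto simp: mem_Times_iff)
  show ?thesis using assms
  proof induction
    case (add f g)
    show ?case using add.IH by (rule continuous_on_add)
  next
    case (mult f g)
    show ?case using mult.IH by (rule continuous_on_mult)
  qed (use * in \<open>(intro continuous_intros; simp)+\<close>)
qed

lemma denom_derivs:
  "((\<lambda>t. a + b * t + c * y + d * t * y) has_real_derivative b + d * y) (at z within S)"
  "((\<lambda>t. a + b * x + c * t + d * x * t) has_real_derivative c + d * x) (at z within S)"
  by (auto intro!: derivative_eq_intros)

text \<open>The hypothesis on \<open>M\<close> enters only in the cross derivatives of the two
  logarithmic derivatives, where \<open>M\<close> becomes a constant factor. Sums and products are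
  handled by the corresponding rules of differentiation.\<close>

lemma signed_class_neg_derivs:
  assumes "f \<in> signed_class a b c d" and M: "b * c - a * d \<ge> 0"
  shows "\<exists>g\<in>signed_class a b c d. \<exists>h\<in>signed_class a b c d. neg_derivs f g h"
  using assms(1)
proof induction
  case (const r)
  have "neg_derivs (\<lambda>x y. r) (\<lambda>x y. 0) (\<lambda>x y. 0)"
    by (auto simp: neg_derivs_def)
  then show ?case using signed_class.const[of 0] by blast
next
  case recip
  let ?p = "\<lambda>x y. a + b * x + c * y + d * x * y"
  have "neg_derivs (\<lambda>x y. 1 / ?p x y) (\<lambda>x y. (b + d * y) / ?p x y * (1 / ?p x y))
    (\<lambda>x y. (c + d * x) / ?p x y * (1 / ?p x y))"
    unfolding neg_derivs_def
  proof (intro allI impI conjI)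
    fix x y :: real assume "x \<ge> 0" "y \<ge> 0"
    then have *: "?p x y \<noteq> 0" using pos[of x y] by simp
    show "((\<lambda>t. 1 / ?p t y) has_real_derivative - ((b + d * y) / ?p x y * (1 / ?p x y))) (at x within {0..})"
      by (rule quotient_deriv[OF _ denom_derivs(1) refl refl *]) (auto intro!: derivative_eq_intros simp: *)
    show "((\<lambda>t. 1 / ?p x t) has_real_derivative - ((c + d * x) / ?p x y * (1 / ?p x y))) (at y within {0..})"
      by (rule quotient_deriv[OF _ denom_derivs(2) refl refl *]) (auto intro!: derivative_eq_intros simp: *)
  qed
  moreover have "(\<lambda>x y. (b + d * y) / (a + b * x + c * y + d * x * y) * (1 / (a + b * x + c * y + d * x * y))) \<in> signed_class a b c d"
    "(\<lambda>x y. (c + d * x) / (a + b * x + c * y + d * x * y) * (1 / (a + b * x + c * y + d * x * y))) \<in> signed_class a b c d"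
    using M by (simp_all only: signed_class.intros)
  ultimately show ?case by blast
next
  case dlog1
  let ?p = "\<lambda>x y. a + b * x + c * y + d * x * y"
  have "neg_derivs (\<lambda>x y. (b + d * y) / ?p x y) (\<lambda>x y. (b + d * y) / ?p x y * ((b + d * y) / ?p x y))
    (\<lambda>x y. (b * c - a * d) * (1 / ?p x y * (1 / ?p x y)))"
    unfolding neg_derivs_def
  proof (intro allI impI conjI)
    fix x y :: real assume "x \<ge> 0" "y \<ge> 0"
    then have *: "?p x y \<noteq> 0" using pos[of x y] by simp
    show "((\<lambda>t. (b + d * y) / ?p t y) has_real_derivative - ((b + d * y) / ?p x y * ((b + d * y) / ?p x y))) (at x within {0..})"
      by (rule quotient_deriv[OF _ denom_derivs(1) refl refl *]) (auto intro!: derivative_eq_intros simp: *)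
    \<comment> \<open>The numerator of the quotient rule is constant: every monomial containing
      \<open>x\<close> or \<open>y\<close> cancels.\<close>
    have "(b + d * y) * (c + d * x) - d * ?p x y = b * c - a * d" by (simp add: algebra_simps)
    then show "((\<lambda>t. (b + d * t) / ?p x t) has_real_derivative - ((b * c - a * d) * (1 / ?p x y * (1 / ?p x y)))) (at y within {0..})"
      by (intro quotient_deriv[OF _ denom_derivs(2) refl refl *, where E = d]) (auto intro!: derivative_eq_intros simp: *)
  qed
  moreover have "(\<lambda>x y. (b + d * y) / (a + b * x + c * y + d * x * y) * ((b + d * y) / (a + b * x + c * y + d * x * y))) \<in> signed_class a b c d"
    "(\<lambda>x y. (b * c - a * d) * (1 / (a + b * x + c * y + d * x * y) * (1 / (a + b * x + c * y + d * x * y)))) \<in> signed_class a b c d"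
    using M by (simp_all only: signed_class.intros)
  ultimately show ?case by blast
next
  case dlog2
  let ?p = "\<lambda>x y. a + b * x + c * y + d * x * y"
  have "neg_derivs (\<lambda>x y. (c + d * x) / ?p x y) (\<lambda>x y. (b * c - a * d) * (1 / ?p x y * (1 / ?p x y)))
    (\<lambda>x y. (c + d * x) / ?p x y * ((c + d * x) / ?p x y))"
    unfolding neg_derivs_def
  proof (intro allI impI conjI)
    fix x y :: real assume "x \<ge> 0" "y \<ge> 0"
    then have *: "?p x y \<noteq> 0" using pos[of x y] by simp
    show "((\<lambda>t. (c + d * x) / ?p x t) has_real_derivative - ((c + d * x) / ?p x y * ((c + d * x) / ?p x y))) (at y within {0..})"
      by (rule quotient_deriv[OF _ denom_derivs(2) refl refl *]) (auto intro!: derivative_eq_intros simp: *)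
    have "(c + d * x) * (b + d * y) - d * ?p x y = b * c - a * d" by (simp add: algebra_simps)
    then show "((\<lambda>t. (c + d * t) / ?p t y) has_real_derivative - ((b * c - a * d) * (1 / ?p x y * (1 / ?p x y)))) (at x within {0..})"
      by (intro quotient_deriv[OF _ denom_derivs(1) refl refl *, where E = d]) (auto intro!: derivative_eq_intros simp: *)
  qed
  moreover have "(\<lambda>x y. (c + d * x) / (a + b * x + c * y + d * x * y) * ((c + d * x) / (a + b * x + c * y + d * x * y))) \<in> signed_class a b c d"
    "(\<lambda>x y. (b * c - a * d) * (1 / (a + b * x + c * y + d * x * y) * (1 / (a + b * x + c * y + d * x * y)))) \<in> signed_class a b c d"
    using M by (simp_all only: signed_class.intros)
  ultimately show ?case by blast
next
  case (add f g)
  then obtain f1 f2 g1 g2 where S: "f1 \<in> signed_class a b c d" "f2 \<in> signed_class a b c d"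
    "g1 \<in> signed_class a b c d" "g2 \<in> signed_class a b c d" and
    D: "neg_derivs f f1 f2" "neg_derivs g g1 g2" by blast
  have "neg_derivs (\<lambda>x y. f x y + g x y) (\<lambda>x y. f1 x y + g1 x y) (\<lambda>x y. f2 x y + g2 x y)"
    by (rule neg_derivs_add[OF D])
  moreover have "(\<lambda>x y. f1 x y + g1 x y) \<in> signed_class a b c d" "(\<lambda>x y. f2 x y + g2 x y) \<in> signed_class a b c d"
    using S by (simp_all add: signed_class.add)
  ultimately show ?case by blast
next
  case (mult f g)
  then obtain f1 f2 g1 g2 where S: "f1 \<in> signed_class a b c d" "f2 \<in> signed_class a b c d"
    "g1 \<in> signed_class a b c d" "g2 \<in> signed_class a b c d" and
    D: "neg_derivs f f1 f2" "neg_derivs g g1 g2" by blast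
  have "neg_derivs (\<lambda>x y. f x y * g x y) (\<lambda>x y. f1 x y * g x y + f x y * g1 x y)
     (\<lambda>x y. f2 x y * g x y + f x y * g2 x y)"
    by (rule neg_derivs_mult[OF D])
  moreover have "(\<lambda>x y. f1 x y * g x y + f x y * g1 x y) \<in> signed_class a b c d"
    "(\<lambda>x y. f2 x y * g x y + f x y * g2 x y) \<in> signed_class a b c d"
    using S mult.hyps by (simp_all add: signed_class.add signed_class.mult)
  ultimately show ?case by blast
qed

text \<open>\<open>\<sigma>\<close> carries the sign accumulated by earlier derivatives.
  \<open>F\<close> is controlled only on the quadrant, so the lemma applies to iterated partial
  derivatives, whose values elsewhere are unknown.\<close>

lemma signed_partials:
  assumes "f \<in> signed_class a b c d" and M: "b * c - a * d \<ge> 0"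
    and F: "\<forall>x\<ge>0. \<forall>y\<ge>0. F x y = \<sigma> * f x y"
  shows "\<exists>g\<in>signed_class a b c d. \<exists>h\<in>signed_class a b c d.
    (\<forall>x\<ge>0. \<forall>y\<ge>0. partial1 F x y = - \<sigma> * g x y) \<and>
    (\<forall>x\<ge>0. \<forall>y\<ge>0. partial2 F x y = - \<sigma> * h x y) \<and>
    (\<forall>x\<ge>0. \<forall>y\<ge>0. (\<lambda>t. F t y) differentiable (at x within {0..}) \<and>
      (\<lambda>t. F x t) differentiable (at y within {0..}))"
proof -
  obtain g h where S: "g \<in> signed_class a b c d" "h \<in> signed_class a b c d" and D: "neg_derivs f g h"
    using signed_class_neg_derivs[OF assms(1,2)] by blast
  have 1: "((\<lambda>t. \<sigma> * f t y) has_real_derivative - \<sigma> * g x y) (at x within {0..})"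
    and 2: "((\<lambda>t. \<sigma> * f x t) has_real_derivative - \<sigma> * h x y) (at y within {0..})"
    if "x \<ge> 0" "y \<ge> 0" for x y
    using D that unfolding neg_derivs_def by (auto intro!: derivative_eq_intros)
  have "(\<lambda>t. F t y) differentiable (at x within {0..}) \<and> partial1 F x y = - \<sigma> * g x y"
    "(\<lambda>t. F x t) differentiable (at y within {0..}) \<and> partial2 F x y = - \<sigma> * h x y"
    if xy: "x \<ge> 0" "y \<ge> 0" for x y
  proof -
    have "F t y = \<sigma> * f t y" if "t \<ge> 0" for t using F xy that by blast
    from vector_derivative_quadrant[OF 1[OF xy] xy(1) this]
    show "(\<lambda>t. F t y) differentiable (at x within {0..}) \<and> partial1 F x y = - \<sigma> * g x y"
      unfolding partial1_def by blast
    have "F x t = \<sigma> * f x t" if "t \<ge> 0" for t using F xy that by blast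
    from vector_derivative_quadrant[OF 2[OF xy] xy(2) this]
    show "(\<lambda>t. F x t) differentiable (at y within {0..}) \<and> partial2 F x y = - \<sigma> * h x y"
      unfolding partial2_def by blast
  qed
  then show ?thesis using S by blast
qed

lemma signed_class_Ck:
  assumes "f \<in> signed_class a b c d" and M: "b * c - a * d \<ge> 0"
    and "\<forall>x\<ge>0. \<forall>y\<ge>0. F x y = \<sigma> * f x y"
  shows "Ck_quadrant k F"
  using assms(1,3)
\<comment> \<open>The induction hypothesis is applied to \<open>partial1 F\<close> and
  \<open>partial2 F\<close>, with \<open>- \<sigma>\<close> and other members of the class.\<close>
proof (induction k arbitrary: f F \<sigma>)
  case (0 f F \<sigma>)
  have "continuous_on ({0..} \<times> {0..}) (\<lambda>z. \<sigma> * f (fst z) (snd z))"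
    by (intro continuous_on_mult continuous_on_const signed_class_continuous 0)
  also have "?this \<longleftrightarrow> continuous_on ({0..} \<times> {0..}) (\<lambda>(x, y). F x y)"
    by (rule continuous_on_cong) (use 0 in auto)
  finally show ?case by simp
next
  case (Suc k f F \<sigma>)
  obtain g h where g: "g \<in> signed_class a b c d" "h \<in> signed_class a b c d"
    "\<forall>x\<ge>0. \<forall>y\<ge>0. partial1 F x y = - \<sigma> * g x y"
    "\<forall>x\<ge>0. \<forall>y\<ge>0. partial2 F x y = - \<sigma> * h x y"
    "\<forall>x\<ge>0. \<forall>y\<ge>0. (\<lambda>t. F t y) differentiable (at x within {0..}) \<and>
      (\<lambda>t. F x t) differentiable (at y within {0..})"
    using signed_partials[OF Suc.prems(1) M Suc.prems(2)] by blast
  have "continuous_on ({0..} \<times> {0..}) (\<lambda>z. \<sigma> * f (fst z) (snd z))"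
    by (intro continuous_on_mult continuous_on_const signed_class_continuous Suc.prems)
  also have "?this \<longleftrightarrow> continuous_on ({0..} \<times> {0..}) (\<lambda>(x, y). F x y)"
    by (rule continuous_on_cong) (use Suc.prems in auto)
  finally show ?case
    unfolding Ck_quadrant.simps by (intro conjI g(5) Suc.IH[OF g(1,3)] Suc.IH[OF g(2,4)])
qed

lemma signed_class_iterated:
  assumes "f \<in> signed_class a b c d" and M: "b * c - a * d \<ge> 0"
    and "\<forall>x\<ge>0. \<forall>y\<ge>0. F x y = f x y"
  shows "\<exists>g\<in>signed_class a b c d. \<forall>x\<ge>0. \<forall>y\<ge>0.
    (partial1 ^^ i) ((partial2 ^^ j) F) x y = (-1) ^ (i + j) * g x y"
proof (induction i)
  case 0
  show ?case
  proof (induction j)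
    case 0
    then show ?case using assms by auto
  next
    case (Suc j)
    then obtain g where "g \<in> signed_class a b c d"
      "\<forall>x\<ge>0. \<forall>y\<ge>0. (partial2 ^^ j) F x y = (-1) ^ j * g x y" by auto
    from signed_partials[OF this(1) M this(2)] show ?case by auto
  qed
next
  case (Suc i)
  then obtain g where "g \<in> signed_class a b c d"
    "\<forall>x\<ge>0. \<forall>y\<ge>0. (partial1 ^^ i) ((partial2 ^^ j) F) x y = (-1) ^ (i + j) * g x y" by auto
  from signed_partials[OF this(1) M this(2)] show ?case by auto
qed

lemma joint_cm_function_if:
  assumes M: "b * c - a * d \<ge> 0"
    and F: "\<forall>x\<ge>0. \<forall>y\<ge>0. F x y = 1 / (a + b * x + c * y + d * x * y)"
  shows "joint_cm_function F"
  unfolding joint_cm_function_def smooth_quadrant_def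
proof (intro conjI allI impI)
  fix k show "Ck_quadrant k F"
    by (rule signed_class_Ck[OF signed_class.recip M, where \<sigma> = 1]) (simp add: F)
next
  fix x y :: real assume "x \<ge> 0" "y \<ge> 0"
  then show "F x y > 0" by (simp add: F pos)
next
  fix i j and x y :: real assume xy: "x \<ge> 0" "y \<ge> 0"
  obtain g where "g \<in> signed_class a b c d"
    "(partial1 ^^ i) ((partial2 ^^ j) F) x y = (-1) ^ (i + j) * g x y"
    using signed_class_iterated[OF signed_class.recip M F, of i j] xy by blast
  then show "(-1) ^ (i + j) * (partial1 ^^ i) ((partial2 ^^ j) F) x y \<ge> 0"
    using signed_class_nonneg xy by simp
qed

text \<open>The derivatives in \<open>x\<close> are followed along the line \<open>y = 1\<close>,
  where the slope \<open>B = b + d\<close> is positive even if \<open>b = 0\<close>. Their signs at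
  \<open>x = 0\<close> force \<open>d * (a + c) + (i + 1) * M \<ge> 0\<close> for every
  \<open>i\<close>, which fails for large \<open>i\<close> if \<open>M < 0\<close>.\<close>

lemma joint_cm_function_only_if:
  assumes F: "\<forall>x\<ge>0. \<forall>y\<ge>0. F x y = 1 / (a + b * x + c * y + d * x * y)"
    and cm: "joint_cm_function F"
  shows "b * c - a * d \<ge> 0"
proof (rule ccontr)
  define M where "M = b * c - a * d"
  assume "\<not> b * c - a * d \<ge> 0"
  then have M: "M < 0" by (simp add: M_def)
  \<comment> \<open>For \<open>d = 0\<close> the number \<open>M = b * c\<close> would be
    nonnegative.\<close>
  have dpos: "d > 0" using M b_nonneg c_nonneg d_nonneg by (cases "d = 0") (auto simp: M_def mult_less_0_iff)
  define B where "B = b + d"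
  have B: "B > 0" using dpos b_nonneg by (simp add: B_def)
  let ?q = "\<lambda>x. a + c + B * x"
  have q: "?q x > 0" if "x \<ge> 0" for x using pos[OF that, of 1] by (simp add: B_def algebra_simps)
  \<comment> \<open>Writing \<open>B ^ i / B\<close> instead of a power with exponent
    \<open>i - 1\<close> keeps the case \<open>i = 0\<close> uniform.\<close>
  have formula: "(partial1 ^^ i) (partial2 F) x 1 =
     (-1) ^ (i + 1) * (fact i * B ^ i / B * (d / ?q x ^ (i + 1) + real (i + 1) * M / ?q x ^ (i + 2)))"
    if "x \<ge> 0" for i x using that
  proof (induction i arbitrary: x)
    case 0
    have "partial2 F x 1 = - ((c + d * x) / (?q x)\<^sup>2)"
      unfolding partial2_def
    proof (rule vector_derivative_quadrant(2)[where g = "\<lambda>y. 1 / (a + b * x + c * y + d * x * y)"])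
      show "((\<lambda>y. 1 / (a + b * x + c * y + d * x * y)) has_real_derivative - ((c + d * x) / (?q x)\<^sup>2)) (at 1 within {0..})"
      proof (rule DERIV_cong[OF DERIV_divide[OF DERIV_const denom_derivs(2)]])
        have "a + b * x + c * 1 + d * x * 1 = ?q x" by (simp add: B_def algebra_simps)
        then show "(0 * (a + b * x + c * 1 + d * x * 1) - 1 * (c + d * x)) /
          ((a + b * x + c * 1 + d * x * 1) * (a + b * x + c * 1 + d * x * 1)) = - ((c + d * x) / (?q x)\<^sup>2)"
          unfolding power2_eq_square by (metis mult_zero_left diff_0 mult_1 minus_divide_left)
        show "a + b * x + c * 1 + d * x * 1 \<noteq> 0" using pos[OF 0, of 1] by simp
      qed
    qed (use F 0 in auto)
    \<comment> \<open>Partial fractions: expressing the numerator through \<open>?q x\<close> leaves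
      only inverse powers of \<open>?q x\<close>, which can be differentiated repeatedly term by
      term.\<close>
    also have "(c + d * x) / (?q x)\<^sup>2 = 1 / B * ((d * ?q x + M) / (?q x)\<^sup>2)"
    proof -
      have "d * ?q x + M = B * (c + d * x)" by (simp add: B_def M_def algebra_simps)
      then show ?thesis using B by simp
    qed
    also have "(d * ?q x + M) / (?q x)\<^sup>2 = d / ?q x + M / (?q x)\<^sup>2"
      using q[OF 0] by (simp add: add_divide_distrib power2_eq_square)
    finally show ?case by (simp add: power2_eq_square diff_divide_distrib add_divide_distrib)
  next
    case (Suc i)
    have "partial1 ((partial1 ^^ i) (partial2 F)) x 1 =
       (-1) ^ (Suc i + 1) * (fact (Suc i) * B ^ (Suc i) / B * (d / ?q x ^ (Suc i + 1) + real (Suc i + 1) * M / ?q x ^ (Suc i + 2)))"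
      unfolding partial1_def[of "(partial1 ^^ i) (partial2 F)"]
    proof (rule vector_derivative_quadrant(2)[OF _ Suc.prems Suc.IH])
      have *: "((\<lambda>t. 1 / ?q t ^ k) has_real_derivative - (real k * B / ?q x ^ (k + 1))) (at x within {0..})" for k
        by (rule DERIV_inverse_power) (use q[OF Suc.prems] in \<open>auto intro!: derivative_eq_intros\<close>)
      have "((\<lambda>t. (-1) ^ (i + 1) * (fact i * B ^ i / B * (d * (1 / ?q t ^ (i + 1)) + real (i + 1) * M * (1 / ?q t ^ (i + 2))))) has_real_derivative
       (-1) ^ (i + 1) * (fact i * B ^ i / B * (d * - (real (i+1) * B / ?q x ^ (i + 1 + 1)) + real (i + 1) * M * - (real (i+2) * B / ?q x ^ (i + 2+1))))) (at x within {0..})"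
        by (intro DERIV_cmult DERIV_add *)
      also have "(-1) ^ (i + 1) * (fact i * B ^ i / B * (d * - (real (i+1) * B / ?q x ^ (i + 1 + 1)) + real (i + 1) * M * - (real (i+2) * B / ?q x ^ (i + 2+1))))
        = (-1) ^ (i + 1) * - ((real (i + 1) * B * (fact i * B ^ i / B)) * (d / ?q x ^ (i + 1 + 1) + real (i + 2) * M / ?q x ^ (i + 2 + 1)))"
        by (simp add: field_class.field_divide_inverse algebra_simps)
      also have "real (i + 1) * B * (fact i * B ^ i / B) = fact (Suc i) * B ^ (Suc i) / B" by simp
      also have "(-1) ^ (i + 1) * - (fact (Suc i) * B ^ (Suc i) / B * (d / ?q x ^ (i + 1 + 1) + real (i + 2) * M / ?q x ^ (i + 2 + 1)))
        = (-1) ^ (Suc i + 1) * (fact (Suc i) * B ^ (Suc i) / B * (d / ?q x ^ (Suc i + 1) + real (Suc i + 1) * M / ?q x ^ (Suc i + 2)))"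
        by (simp add: add_ac)
      finally show "((\<lambda>t. (-1) ^ (i + 1) * (fact i * B ^ i / B * (d / ?q t ^ (i + 1) + real (i + 1) * M / ?q t ^ (i + 2)))) has_real_derivative
       (-1) ^ (Suc i + 1) * (fact (Suc i) * B ^ (Suc i) / B * (d / ?q x ^ (Suc i + 1) + real (Suc i + 1) * M / ?q x ^ (Suc i + 2)))) (at x within {0..})"
        by simp
    qed auto
    then show ?case by simp
  qed
  have q0: "a + c > 0" using q[of 0] by simp
  have "d * (a + c) + real (i + 1) * M \<ge> 0" for i
  proof -
    have "(-1) ^ (i + 1) * (partial1 ^^ i) ((partial2 ^^ 1) F) 0 1 \<ge> 0"
      using cm unfolding joint_cm_function_def by (meson order_refl zero_le_one)
    then have "fact i * B ^ i / B * (d / (a + c) ^ (i + 1) + real (i + 1) * M / (a + c) ^ (i + 2)) \<ge> 0"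
      using formula[of 0 i] by (simp add: power_add[symmetric] mult.assoc[symmetric])
    moreover have "fact i * B ^ i / B > 0" using B by simp
    ultimately have "d / (a + c) ^ (i + 1) + real (i + 1) * M / (a + c) ^ (i + 2) \<ge> 0"
      using zero_le_mult_iff by (metis not_less)
    moreover have "w > 0 \<Longrightarrow> d / w ^ (i + 1) + e / w ^ (i + 2) = (d * w + e) / w ^ (i + 2)" for w e :: real
      by (simp add: field_simps)
    ultimately have "0 \<le> (d * (a + c) + real (i + 1) * M) / (a + c) ^ (i + 2)"
      using q0 by metis
    then show ?thesis using q0 zero_less_power[OF q0, of "i + 2"] by (metis divide_neg_pos not_less)
  qed
  note bound = this
  obtain n where "real n > d * (a + c) / (- M)" using reals_Archimedean2 by blast
  have "real n * - M \<le> d * (a + c) + M"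
    using bound[of n] by (simp add: algebra_simps)
  moreover have "d * (a + c) < real n * - M"
    using \<open>real n > d * (a + c) / (- M)\<close> pos_divide_less_eq[of "- M"] M by (simp only: neg_0_less_iff_less)
  ultimately show False using M by simp
qed

end

section \<open>Finite differences of reciprocals\<close>

lemma fdiff_funpow_diff: "(fdiff ^^ j) (\<lambda>k. u k - v k) = (\<lambda>k. (fdiff ^^ j) u k - (fdiff ^^ j) v k)"
  by (induction j) (auto simp: fdiff_def fun_eq_iff)

lemma fdiff1_funpow: "(fdiff1 ^^ i) u = (\<lambda>m n. (fdiff ^^ i) (\<lambda>m. u m n) m)"
  by (induction i) (auto simp: fdiff_def fdiff1_def fun_eq_iff)

text \<open>The alternating sign at 0 means that removing an atom of size \<open>\<epsilon>\<close>
  there lowers every signed difference at 0 by exactly \<open>\<epsilon>\<close>.\<close>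

lemma fdiff_funpow_atom:
  "(fdiff ^^ j) (\<lambda>k. \<epsilon> * indicator {0} k) = (\<lambda>k. if k = 0 then (-1) ^ j * \<epsilon> else 0)"
  by (induction j) (auto simp: fdiff_def fun_eq_iff)

text \<open>The discrete analogue of differentiating \<open>1 / (A + B * x)\<close> repeatedly. The
  products starting at \<open>m\<close> and at \<open>m + 1\<close> share all factors but the
  outermost ones \<open>x\<close> and \<open>y\<close>, and \<open>y - x = B * (i + 1)\<close>
  supplies the next factor of the numerator.\<close>

lemma fdiff_funpow_reciprocal:
  assumes "A > 0" "B > 0"
  shows "(fdiff ^^ i) (\<lambda>k. 1 / (A + B * real k)) m =
    (-1) ^ i * (fact i * B ^ i / (\<Prod>k\<le>i. A + B * real (m + k)))"
proof (induction i arbitrary: m)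
  case (Suc i)
  have pos: "A + B * real k > 0" for k using assms by (simp add: add_pos_nonneg)
  define P where "P = (\<Prod>k=1..i. A + B * real (m + k))"
  define x y where "x = A + B * real m" and "y = A + B * real (m + Suc i)"
  have xy: "x > 0" "y > 0" and P: "P > 0"
    unfolding x_def y_def P_def by (intro pos prod_pos)+
  have 1: "(\<Prod>k\<le>i. A + B * real (m + k)) = x * P"
    unfolding P_def x_def atMost_atLeast0 by (simp add: prod.atLeast_Suc_atMost)
  have 2: "(\<Prod>k\<le>i. A + B * real (m + 1 + k)) = P * y"
  proof -
    have "(\<Prod>k\<le>i. A + B * real (m + 1 + k)) = (\<Prod>k=Suc 0..Suc i. A + B * real (m + k))"
      unfolding prod.shift_bounds_cl_Suc_ivl atMost_atLeast0 by simp
    then show ?thesis by (simp add: P_def y_def)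
  qed
  have 3: "(\<Prod>k\<le>Suc i. A + B * real (m + k)) = x * P * y"
    using 1 by (simp add: y_def)
  have yx: "y - x = B * (real i + 1)" by (simp add: x_def y_def algebra_simps)
  let ?f = "\<lambda>k. 1 / (A + B * real k)"
  have "(fdiff ^^ Suc i) ?f m = (fdiff ^^ i) ?f (m + 1) - (fdiff ^^ i) ?f m"
    by (simp add: fdiff_def)
  also have "\<dots> = (-1) ^ i * (fact i * B ^ i / (P * y)) - (-1) ^ i * (fact i * B ^ i / (x * P))"
    by (simp only: Suc.IH 1 2)
  also have "\<dots> = (-1) ^ i * (fact i * B ^ i) * (1 / (P * y) - 1 / (x * P))"
    by (simp add: right_diff_distrib)
  also have "1 / (P * y) - 1 / (x * P) = - (y - x) / (x * P * y)"
    using xy P by (simp add: field_simps)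
  finally show ?case unfolding yx 3 by (simp add: algebra_simps)
qed simp

text \<open>A product of factors \<open>1 + x_k\<close> with \<open>x_k \<ge> 0\<close> is at least
  the sum of the \<open>x_k\<close>, and this sum dominates a positive multiple of the harmonic
  numbers.\<close>

lemma harmonic_product_unbounded:
  fixes r \<delta> :: real
  assumes "r \<ge> 0" "\<delta> > 0"
  shows "\<exists>i. K < (\<Prod>k=1..i. 1 + \<delta> / (real k + r))"
proof -
  have 1: "(\<Sum>k=1..i. \<delta> / (real k + r)) \<le> (\<Prod>k=1..i. 1 + \<delta> / (real k + r))" for i
  proof -
    have "1 + (\<Sum>k=1..i. \<delta> / (real k + r)) \<le> (\<Prod>k=1..i. 1 + \<delta> / (real k + r))"
    proof (induction i)
      case (Suc i)
      have "1 \<le> (\<Prod>k=1..i. 1 + \<delta> / (real k + r))"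
        using assms by (intro prod_ge_1) auto
      then have "\<delta> / (real (Suc i) + r) \<le> (\<Prod>k=1..i. 1 + \<delta> / (real k + r)) * (\<delta> / (real (Suc i) + r))"
        using assms mult_right_mono[of 1 _ "\<delta> / (real (Suc i) + r)"] by simp
      with Suc show ?case by (simp add: algebra_simps)
    qed simp
    then show ?thesis by simp
  qed
  have 2: "\<delta> / (1 + r) * harm i \<le> (\<Sum>k=1..i. \<delta> / (real k + r))" for i
    unfolding harm_def sum_distrib_left
  proof (rule sum_mono)
    fix k assume k: "k \<in> {1..i}"
    have "r \<le> r * real k" using k assms mult_left_mono[of 1 "real k" r] by simp
    then have "real k + r \<le> (1 + r) * real k" by (simp add: algebra_simps)
    then have "\<delta> / ((1 + r) * real k) \<le> \<delta> / (real k + r)"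
      using k assms by (intro divide_left_mono) auto
    then show "\<delta> / (1 + r) * inverse (of_nat k) \<le> \<delta> / (real k + r)"
      by (simp add: field_class.field_divide_inverse mult_ac)
  qed
  have "filterlim (\<lambda>i. \<delta> / (1 + r) * harm i) at_top sequentially"
    using assms by (intro filterlim_tendsto_pos_mult_at_top[OF tendsto_const] harm_at_top) auto
  then have "eventually (\<lambda>i. K < \<delta> / (1 + r) * harm i) sequentially"
    unfolding filterlim_at_top_dense by blast
  then obtain i where "\<delta> / (1 + r) * harm i > K"
    by (meson eventually_sequentially order_refl)
  then show ?thesis using 1[of i] 2[of i] by (intro exI[of _ i]) linarith
qed

context bilinear_pos
begin

text \<open>In the row of index \<open>n\<close>, the \<open>i\<close>-th difference at 0 is a positive multiple of
  the reciprocal of \<open>A \<Prod>\<^sub>k (k + A/B)\<close> with \<open>A = a + c n\<close>, \<open>B = b + d n\<close>;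
  when \<open>b c < a d\<close> the ratio \<open>A/B\<close> decreases from row 1 to row 2, and
  the divergence of the harmonic series makes the difference grow.\<close>

lemma joint_cm_net_only_if:
  assumes cm: "joint_cm_net (\<lambda>m n. 1 / (a + b * real m + c * real n + d * real m * real n))"
  shows "b * c - a * d \<ge> 0"
proof (rule ccontr)
  define M where "M = b * c - a * d"
  assume "\<not> b * c - a * d \<ge> 0"
  then have M: "M < 0" by (simp add: M_def)
  have dpos: "d > 0" using M b_nonneg c_nonneg d_nonneg by (cases "d = 0") (auto simp: M_def mult_less_0_iff)
  \<comment> \<open>Rows 1 and 2 are compared instead of rows 0 and 1 because the slope
    \<open>b\<close> of row 0 may vanish.\<close>
  define A1 B1 A2 B2 where "A1 = a + c" and "B1 = b + d" and "A2 = a + 2 * c" and "B2 = b + 2 * d"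
  have pos: "A1 > 0" "B1 > 0" "A2 > 0" "B2 > 0"
    using a_pos b_nonneg c_nonneg dpos by (auto simp: A1_def A2_def B1_def B2_def)
  define r1 r2 where "r1 = A1 / B1" and "r2 = A2 / B2"
  have r: "r2 > 0" "r1 > 0" using pos by (auto simp: r1_def r2_def)
  \<comment> \<open>After cross-multiplication this is
    \<open>A1 * B2 - A2 * B1 = - M > 0\<close>.\<close>
  have r12: "r2 < r1"
    using M pos unfolding r1_def r2_def
    by (simp add: field_simps) (simp add: A1_def A2_def B1_def B2_def M_def algebra_simps)
  define G where "G = (\<lambda>(i::nat) A B. fact i * B ^ i / (\<Prod>k\<le>i. A + B * real (0 + k)))"
  have G_eq: "G i A B = fact i / A * (\<Prod>k=1..i. 1 / (real k + A / B))" if "A > 0" "B > 0" for i A B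
  proof -
    have "(\<Prod>k\<le>i. A + B * real (0 + k)) = A * (\<Prod>k=1..i. A + B * real k)"
      unfolding atMost_atLeast0 by (simp add: prod.atLeast_Suc_atMost)
    also have "(\<Prod>k=1..i. A + B * real k) = (\<Prod>k=1..i. B * (real k + A / B))"
      using that by (intro prod.cong) (auto simp: field_simps)
    also have "\<dots> = B ^ i * (\<Prod>k=1..i. real k + A / B)"
      by (simp add: prod.distrib)
    finally show ?thesis using that by (simp add: G_def prod_dividef)
  qed
  have "G i A2 B2 \<le> G i A1 B1" for i
  proof -
    let ?u = "\<lambda>m n. 1 / (a + b * real m + c * real n + d * real m * real n)"
    have row: "(\<lambda>m. ?u m n) = (\<lambda>k. 1 / ((a + c * real n) + (b + d * real n) * real k))" for n
      by (simp add: algebra_simps)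
    have "(-1) ^ (i + 1) * (fdiff1 ^^ i) ((fdiff2 ^^ 1) ?u) 0 1 \<ge> 0"
      using cm unfolding joint_cm_net_def by blast
    also have "(fdiff1 ^^ i) ((fdiff2 ^^ 1) ?u) 0 1 = (fdiff ^^ i) (\<lambda>m. ?u m (1 + 1) - ?u m 1) 0"
      unfolding fdiff1_funpow by (simp only: fdiff2_def funpow.simps(2) One_nat_def funpow.simps(1) comp_def id_apply)
    also have "\<dots> = (fdiff ^^ i) (\<lambda>m. ?u m (1 + 1)) 0 - (fdiff ^^ i) (\<lambda>m. ?u m 1) 0"
      unfolding fdiff_funpow_diff ..
    also have "\<dots> = (-1) ^ i * (G i A2 B2 - G i A1 B1)"
      unfolding row G_def using pos fdiff_funpow_reciprocal[of A1 B1 i 0] fdiff_funpow_reciprocal[of A2 B2 i 0]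
      by (simp add: A1_def A2_def B1_def B2_def mult.commute right_diff_distrib)
    finally show ?thesis by (simp add: mult.assoc[symmetric] power_add[symmetric])
  qed
  \<comment> \<open>The threshold \<open>A2 / A1\<close> is the one beyond which the difference in
    row 2 exceeds that in row 1, against monotonicity.\<close>
  moreover obtain i where i: "A2 / A1 < (\<Prod>k=1..i. 1 + (r1 - r2) / (real k + r2))"
    using harmonic_product_unbounded[of r2 "r1 - r2" "A2 / A1"] r r12 by auto
  ultimately have le: "G i A2 B2 \<le> G i A1 B1" by blast
  define Q1 Q2 where "Q1 = (\<Prod>k=1..i. real k + r1)" and "Q2 = (\<Prod>k=1..i. real k + r2)"
  have Q: "Q1 > 0" "Q2 > 0" unfolding Q1_def Q2_def using r by (auto intro!: prod_pos)
  have "(\<Prod>k=1..i. 1 + (r1 - r2) / (real k + r2)) = (\<Prod>k=1..i. (real k + r1) / (real k + r2))"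
    using r by (intro prod.cong) (auto simp: field_simps)
  also have "\<dots> = Q1 / Q2" by (simp add: Q1_def Q2_def prod_dividef)
  finally have "A2 / A1 < Q1 / Q2" using i by simp
  then have lt: "A2 * Q2 < A1 * Q1"
    using pos Q by (simp add: field_simps)
  have "fact i / (A2 * Q2) \<le> fact i / (A1 * Q1)"
    using le pos unfolding G_eq[OF pos(1,2)] G_eq[OF pos(3,4)]
    by (simp add: Q1_def Q2_def r1_def r2_def prod_dividef)
  moreover have "fact i / (A1 * Q1) < fact i / (A2 * Q2)"
    using lt pos Q by (intro divide_strict_left_mono) auto
  ultimately show False by simp
qed

end

section \<open>Moment nets\<close>

lemma (in finite_measure) integrable_unit_powers:
  fixes f g :: "'a \<Rightarrow> real"
  assumes [measurable]: "f \<in> borel_measurable M" "g \<in> borel_measurable M"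
    and "AE x in M. 0 \<le> f x \<and> f x \<le> 1" "AE x in M. 0 \<le> g x \<and> g x \<le> 1"
  shows "integrable M (\<lambda>x. f x ^ m * g x ^ n * (f x - 1) ^ i * (g x - 1) ^ j)"
proof (rule integrable_const_bound[of _ 1])
  show "AE x in M. norm (f x ^ m * g x ^ n * (f x - 1) ^ i * (g x - 1) ^ j) \<le> 1"
    using assms(3,4)
    by eventually_elim (auto simp: abs_mult power_abs intro!: mult_le_one power_le_one)
qed measurable

text \<open>Each difference in \<open>m\<close> or \<open>n\<close> multiplies the integrand by
  \<open>f x - 1\<close> or \<open>g x - 1\<close>. General \<open>f\<close> and \<open>g\<close>
  cover both the coordinates of a measure on the square and two powers of a single variable.\<close>

lemma (in finite_measure) fdiff_moments:
  fixes f g :: "'a \<Rightarrow> real"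
  assumes [measurable]: "f \<in> borel_measurable M" "g \<in> borel_measurable M"
    and AE: "AE x in M. 0 \<le> f x \<and> f x \<le> 1" "AE x in M. 0 \<le> g x \<and> g x \<le> 1"
  shows "(fdiff1 ^^ i) ((fdiff2 ^^ j) (\<lambda>m n. \<integral>x. f x ^ m * g x ^ n \<partial>M)) =
    (\<lambda>m n. \<integral>x. f x ^ m * g x ^ n * (f x - 1) ^ i * (g x - 1) ^ j \<partial>M)"
proof (induction i)
  case 0
  show ?case
  proof (induction j)
    case (Suc j)
    show ?case
    proof (intro ext)
      fix m n
      let ?U = "\<lambda>m n. \<integral>x. f x ^ m * g x ^ n \<partial>M"
      let ?F = "\<lambda>n x. f x ^ m * g x ^ n * (f x - 1) ^ 0 * (g x - 1) ^ j"
      have "(fdiff1 ^^ 0) ((fdiff2 ^^ Suc j) (\<lambda>m n. \<integral>x. f x ^ m * g x ^ n \<partial>M)) m n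
        = (fdiff2 ^^ j) ?U m (n + 1) - (fdiff2 ^^ j) ?U m n"
        by (simp add: fdiff2_def[of "(fdiff2 ^^ j) _"])
      also have "\<dots> = (\<integral>x. ?F (n + 1) x \<partial>M) - (\<integral>x. ?F n x \<partial>M)"
        using Suc by simp
      also have "\<dots> = (\<integral>x. ?F (n + 1) x - ?F n x \<partial>M)"
        by (intro Bochner_Integration.integral_diff[symmetric] integrable_unit_powers assms)
      finally show "(fdiff1 ^^ 0) ((fdiff2 ^^ Suc j) (\<lambda>m n. \<integral>x. f x ^ m * g x ^ n \<partial>M)) m n
        = (\<integral>x. f x ^ m * g x ^ n * (f x - 1) ^ 0 * (g x - 1) ^ Suc j \<partial>M)"
        by (simp add: algebra_simps)
    qed
  qed simp
next
  case (Suc i)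
  show ?case
  proof (intro ext)
    fix m n
    let ?U = "\<lambda>m n. \<integral>x. f x ^ m * g x ^ n \<partial>M"
    let ?F = "\<lambda>m x. f x ^ m * g x ^ n * (f x - 1) ^ i * (g x - 1) ^ j"
    have "(fdiff1 ^^ Suc i) ((fdiff2 ^^ j) (\<lambda>m n. \<integral>x. f x ^ m * g x ^ n \<partial>M)) m n
      = (fdiff1 ^^ i) ((fdiff2 ^^ j) ?U) (m + 1) n - (fdiff1 ^^ i) ((fdiff2 ^^ j) ?U) m n"
      by (simp add: fdiff1_def[of "(fdiff1 ^^ i) _"])
    also have "\<dots> = (\<integral>x. ?F (m + 1) x \<partial>M) - (\<integral>x. ?F m x \<partial>M)"
      unfolding Suc ..
    also have "\<dots> = (\<integral>x. ?F (m + 1) x - ?F m x \<partial>M)"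
      by (intro Bochner_Integration.integral_diff[symmetric] integrable_unit_powers assms)
    finally show "(fdiff1 ^^ Suc i) ((fdiff2 ^^ j) (\<lambda>m n. \<integral>x. f x ^ m * g x ^ n \<partial>M)) m n
      = (\<integral>x. f x ^ m * g x ^ n * (f x - 1) ^ Suc i * (g x - 1) ^ j \<partial>M)"
      by (simp add: algebra_simps)
  qed
qed

text \<open>Once the sign is distributed, the integrand is a product of powers of \<open>f\<close>,
  \<open>g\<close>, \<open>1 - f\<close> and \<open>1 - g\<close>, all nonnegative almost
  everywhere.\<close>

lemma (in finite_measure) joint_cm_net_moments:
  fixes f g :: "'a \<Rightarrow> real"
  assumes [measurable]: "f \<in> borel_measurable M" "g \<in> borel_measurable M"
    and AE: "AE x in M. 0 \<le> f x \<and> f x \<le> 1" "AE x in M. 0 \<le> g x \<and> g x \<le> 1"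
    and u: "\<And>m n. u m n = (\<integral>x. f x ^ m * g x ^ n \<partial>M)"
  shows "joint_cm_net u"
  unfolding joint_cm_net_def
proof (intro allI)
  fix i j m n
  have "u = (\<lambda>m n. \<integral>x. f x ^ m * g x ^ n \<partial>M)" using u by blast
  then have "(-1) ^ (i + j) * (fdiff1 ^^ i) ((fdiff2 ^^ j) u) m n =
    (\<integral>x. (-1) ^ (i + j) * (f x ^ m * g x ^ n * (f x - 1) ^ i * (g x - 1) ^ j) \<partial>M)"
    using fdiff_moments[OF assms(1-4)] by simp
  also have "\<dots> \<ge> 0"
  proof (rule integral_nonneg_AE)
    show "AE x in M. 0 \<le> (-1) ^ (i + j) * (f x ^ m * g x ^ n * (f x - 1) ^ i * (g x - 1) ^ j)"
      using AE
    proof eventually_elim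
      fix x assume x: "0 \<le> f x \<and> f x \<le> 1" "0 \<le> g x \<and> g x \<le> 1"
      have "(-1) ^ (i + j) * (f x ^ m * g x ^ n * (f x - 1) ^ i * (g x - 1) ^ j)
        = f x ^ m * g x ^ n * (- 1 * (f x - 1)) ^ i * (- 1 * (g x - 1)) ^ j"
        unfolding power_mult_distrib power_add by (simp only: mult_ac)
      also have "\<dots> = f x ^ m * g x ^ n * (1 - f x) ^ i * (1 - g x) ^ j" by simp
      also have "\<dots> \<ge> 0" using x by simp
      finally show "0 \<le> (-1) ^ (i + j) * (f x ^ m * g x ^ n * (f x - 1) ^ i * (g x - 1) ^ j)" .
    qed
  qed
  finally show "0 \<le> (-1) ^ (i + j) * (fdiff1 ^^ i) ((fdiff2 ^^ j) u) m n" .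
qed

text \<open>Complete monotonicity of the reduced sequence bounds \<open>\<epsilon>\<close> by every
  moment of \<open>1 - f\<close>. As \<open>f > 0\<close> almost everywhere, these moments tend to 0
  by dominated convergence.\<close>

lemma (in finite_measure) minimal_moments:
  fixes f :: "'a \<Rightarrow> real"
  assumes [measurable]: "f \<in> borel_measurable M"
    and AE: "AE x in M. 0 < f x \<and> f x \<le> 1"
    and v: "\<And>m. v m = (\<integral>x. f x ^ m \<partial>M)" and "\<epsilon> > 0"
  shows "\<not> cm_sequence (\<lambda>k. v k - \<epsilon> * indicator {0} k)"
proof
  assume cm: "cm_sequence (\<lambda>k. v k - \<epsilon> * indicator {0} k)"
  have AE': "AE x in M. 0 \<le> f x \<and> f x \<le> 1" using AE by eventually_elim auto
  have ge: "\<epsilon> \<le> (\<integral>x. (1 - f x) ^ j \<partial>M)" for j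
  proof -
    have "(fdiff1 ^^ j) (\<lambda>m n. v m) = (\<lambda>m n. \<integral>x. f x ^ m * (f x - 1) ^ j \<partial>M)"
      \<comment> \<open>The one-variable case is the net with second function constantly 1.\<close>
      using fdiff_moments[of f "\<lambda>_. 1" j 0] AE' v by simp
    then have "(fdiff ^^ j) v 0 = (\<integral>x. (f x - 1) ^ j \<partial>M)"
      unfolding fdiff1_funpow by (metis (no_types, lifting) mult_1 power_0 Bochner_Integration.integral_cong)
    moreover have "0 \<le> (-1) ^ j * (fdiff ^^ j) (\<lambda>k. v k - \<epsilon> * indicator {0} k) 0"
      using cm unfolding cm_sequence_def by blast
    ultimately have "\<epsilon> \<le> (-1) ^ j * (\<integral>x. (f x - 1) ^ j \<partial>M)"
      by (simp add: fdiff_funpow_diff fdiff_funpow_atom right_diff_distrib flip: mult.assoc power_add)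
    also have "\<dots> = (\<integral>x. (1 - f x) ^ j \<partial>M)"
      by (simp flip: integral_mult_right_zero power_mult_distrib)
    finally show ?thesis .
  qed
  have "(\<lambda>j. \<integral>x. (1 - f x) ^ j \<partial>M) \<longlonglongrightarrow> (\<integral>x. 0 \<partial>M)"
  proof (rule integral_dominated_convergence[where w = "\<lambda>_. 1"])
    show "AE x in M. (\<lambda>j. (1 - f x) ^ j) \<longlonglongrightarrow> 0"
      using AE by eventually_elim (auto intro!: LIMSEQ_power_zero)
    show "AE x in M. norm ((1 - f x) ^ j) \<le> 1" for j
      using AE by eventually_elim (auto simp: power_abs intro!: power_le_one)
  qed auto
  then have "\<epsilon> \<le> (\<integral>x. 0 \<partial>M)"
    by (rule tendsto_lowerbound) (use ge in auto)
  with \<open>\<epsilon> > 0\<close> show False by simp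
qed

lemma (in finite_measure) minimal_net_moments:
  fixes f g :: "'a \<Rightarrow> real"
  assumes "f \<in> borel_measurable M" "g \<in> borel_measurable M"
    and "AE x in M. 0 < f x \<and> f x \<le> 1" "AE x in M. 0 < g x \<and> g x \<le> 1"
    and u: "\<And>m n. u m n = (\<integral>x. f x ^ m * g x ^ n \<partial>M)"
  shows "minimal_net u"
  unfolding minimal_net_def
  using minimal_moments[OF assms(1,3)] minimal_moments[OF assms(2,4)] u by simp

section \<open>Logarithmic densities\<close>

text \<open>For \<open>s > 0\<close> and \<open>q > 0\<close>, the antiderivative of
  \<open>s powr (q - 1) * (- ln s) ^ n\<close> produced by repeated integration by parts.\<close>

primrec log_power_primitive :: "real \<Rightarrow> nat \<Rightarrow> real \<Rightarrow> real" where
  "log_power_primitive q 0 = (\<lambda>s. s powr q / q)"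
| "log_power_primitive q (Suc n) =
     (\<lambda>s. (s powr q * (- ln s) ^ Suc n + real (Suc n) * log_power_primitive q n s) / q)"

lemma log_power_primitive_deriv:
  assumes "q > 0" "s > 0"
  shows "(log_power_primitive q n has_real_derivative s powr (q - 1) * (- ln s) ^ n) (at s)"
proof (induction n)
  case 0
  show ?case using assms by (auto intro!: derivative_eq_intros)
next
  case (Suc n)
  have 1: "((\<lambda>s. s powr q) has_real_derivative q * s powr (q - 1)) (at s)"
    using assms by (auto intro!: derivative_eq_intros)
  have "((\<lambda>s. - ln s) has_real_derivative - 1 / s) (at s)"
    using assms by (auto intro!: derivative_eq_intros)
  from DERIV_power[OF this, of "Suc n"]
  have 2: "((\<lambda>s. (- ln s) ^ Suc n) has_real_derivative real (Suc n) * (- 1 / s * (- ln s) ^ n)) (at s)"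
    by simp
  have 3: "s powr q * (1 / s) = s powr (q - 1)" using assms by (simp add: powr_diff)
  show ?case unfolding log_power_primitive.simps
  proof (rule DERIV_cong[OF DERIV_cdivide[OF DERIV_add[OF DERIV_mult[OF 1 2] DERIV_cmult[OF Suc, of "real (Suc n)"]]]])
    have "(q * s powr (q - 1) * (- ln s) ^ Suc n + real (Suc n) * (- 1 / s * (- ln s) ^ n) * s powr q +
       real (Suc n) * (s powr (q - 1) * (- ln s) ^ n)) / q =
       (q * s powr (q - 1) * (- ln s) ^ Suc n + real (Suc n) * (- ln s) ^ n * (s powr (q - 1) - s powr q * (1 / s))) / q"
      by (simp add: algebra_simps add_divide_distrib)
    also have "\<dots> = s powr (q - 1) * (- ln s) ^ Suc n" using assms(1) unfolding 3 by simp
    finally show "(q * s powr (q - 1) * (- ln s) ^ Suc n + real (Suc n) * (- 1 / s * (- ln s) ^ n) * s powr q +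
       real (Suc n) * (s powr (q - 1) * (- ln s) ^ n)) / q = s powr (q - 1) * (- ln s) ^ Suc n" .
  qed
qed

lemma powr_ln_power_tendsto_0:
  fixes q :: real
  assumes "q > 0"
  shows "((\<lambda>s. s powr q * (- ln s) ^ n) \<longlongrightarrow> 0) (at_right 0)"
proof -
  have "((\<lambda>s::real. s powr q * (- ln s) powr real n) \<longlongrightarrow> 0) (at_right 0)"
    using assms by real_asymp
  moreover have "eventually (\<lambda>s::real. s \<in> {0<..<1}) (at_right 0)"
    by (rule eventually_at_right_real) simp
  then have "eventually (\<lambda>s::real. s powr q * (- ln s) powr real n = s powr q * (- ln s) ^ n) (at_right 0)"
    by eventually_elim (simp add: powr_realpow)
  ultimately show ?thesis by (rule Lim_transform_eventually)
qed

lemma log_power_primitive_tendsto_0: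
  assumes "q > 0"
  shows "(log_power_primitive q n \<longlongrightarrow> 0) (at_right 0)"
proof (induction n)
  case 0
  show ?case using tendsto_divide[OF powr_ln_power_tendsto_0[OF assms, of 0] tendsto_const[of q]] assms by simp
next
  case (Suc n)
  have "((\<lambda>s. (s powr q * (- ln s) ^ Suc n + real (Suc n) * log_power_primitive q n s) / q) \<longlongrightarrow>
    (0 + real (Suc n) * 0) / q) (at_right 0)"
    using assms by (intro tendsto_intros Suc powr_ln_power_tendsto_0) auto
  then show ?case by simp
qed

lemma log_power_primitive_1: "q > 0 \<Longrightarrow> log_power_primitive q n 1 = fact n / q ^ Suc n"
  by (induction n) (auto simp: field_simps)

text \<open>The Gamma integral in the variable \<open>s = exp (- x)\<close>. The integrand may be
  unbounded at 0, so the fundamental theorem is applied on the open interval with the limits of the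
  primitive at both ends.\<close>

lemma nn_integral_log_power:
  assumes "q > 0"
  shows "(\<integral>\<^sup>+s. ennreal (s powr (q - 1) * (- ln s) ^ n) * indicator {0<..<1} s \<partial>lborel) =
    ennreal (fact n / q ^ Suc n)"
proof -
  let ?f = "\<lambda>s. s powr (q - 1) * (- ln s) ^ n"
  have e: "einterval 0 1 = {0<..<1::real}"
    unfolding zero_ereal_def one_ereal_def einterval_eq_Icc by simp
  have A: "((log_power_primitive q n \<circ> real_of_ereal) \<longlongrightarrow> 0) (at_right 0)"
    unfolding zero_ereal_def ereal_tendsto_simps1 by (rule log_power_primitive_tendsto_0[OF assms])
  have "isCont (log_power_primitive q n) 1"
    by (rule DERIV_isCont[OF log_power_primitive_deriv[OF assms]]) simp
  then have B: "((log_power_primitive q n \<circ> real_of_ereal) \<longlongrightarrow> fact n / q ^ Suc n) (at_left 1)"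
    unfolding one_ereal_def ereal_tendsto_simps1 isCont_def filterlim_at_split
    by (simp add: log_power_primitive_1[OF assms])
  have *: "set_integrable lborel (einterval 0 1) ?f" "(LBINT x=0..1. ?f x) = fact n / q ^ Suc n - 0"
  proof (rule_tac[!] interval_integral_FTC_nonneg[OF _ _ _ _ A B])
    show "AE x in lborel. 0 < ereal x \<longrightarrow> ereal x < 1 \<longrightarrow> 0 \<le> ?f x"
      by (auto simp: zero_ereal_def one_ereal_def)
    then show "AE x in lborel. 0 < ereal x \<longrightarrow> ereal x < 1 \<longrightarrow> 0 \<le> ?f x" .
  qed (auto intro!: log_power_primitive_deriv[OF assms] continuous_intros simp: zero_ereal_def one_ereal_def)
  have "(LBINT x=0..1. ?f x) = (\<integral>x. indicator {0<..<1} x * ?f x \<partial>lborel)"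
    by (simp add: interval_lebesgue_integral_def e set_lebesgue_integral_def)
  moreover have "integrable lborel (\<lambda>x. indicator {0<..<1} x * ?f x)"
    using *(1) by (simp add: set_integrable_def e)
  then have "(\<integral>\<^sup>+x. ennreal (indicator {0<..<1} x * ?f x) \<partial>lborel) = (\<integral>x. indicator {0<..<1} x * ?f x \<partial>lborel)"
    by (rule nn_integral_eq_integral) (auto simp: indicator_def)
  ultimately show ?thesis
    using *(2) by (simp add: indicator_mult_ennreal mult.commute flip: ennreal_mult'')
qed

text \<open>The one-dimensional measure behind the case \<open>d = 0\<close>: with
  \<open>\<kappa> = 1 / b ^ Suc r\<close> and \<open>q = a / b\<close> its image on the curve is
  \<open>curve_measure\<close>; with \<open>\<kappa> = 1\<close> and \<open>q = a\<close> it also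
  serves \<open>b = 0\<close>.\<close>

definition log_measure :: "real \<Rightarrow> real \<Rightarrow> nat \<Rightarrow> real measure" where
  "log_measure \<kappa> q r = density (restrict_space lborel {0..1})
     (\<lambda>s. ennreal (\<kappa> * (s powr (q - 1) * (- ln s) ^ r / fact r)))"

text \<open>The powers of \<open>s\<close> in the integrand only shift the exponent
  \<open>q\<close>, so the Gamma integral applies with the shifted value \<open>Q\<close>.\<close>

lemma log_measure_moments:
  assumes "\<kappa> \<ge> 0" "q > 0" "\<beta> \<ge> 0" "\<gamma> \<ge> 0"
  shows "(\<integral>\<^sup>+s. ennreal ((s powr \<beta>) ^ m * (s powr \<gamma>) ^ n) \<partial>log_measure \<kappa> q r) =
    ennreal (\<kappa> / (q + \<beta> * m + \<gamma> * n) ^ Suc r)"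
proof -
  define Q where "Q = q + \<beta> * m + \<gamma> * n"
  have Q: "Q > 0" unfolding Q_def using assms by (intro add_pos_nonneg) auto
  have "(\<integral>\<^sup>+s. ennreal ((s powr \<beta>) ^ m * (s powr \<gamma>) ^ n) \<partial>log_measure \<kappa> q r)
    = (\<integral>\<^sup>+s. ennreal (\<kappa> * (s powr (q - 1) * (- ln s) ^ r / fact r)) *
        ennreal ((s powr \<beta>) ^ m * (s powr \<gamma>) ^ n) * indicator {0..1} s \<partial>lborel)"
    unfolding log_measure_def
    by (subst nn_integral_density) (auto simp: nn_integral_restrict_space intro!: measurable_restrict_space1)
  also have "\<dots> = (\<integral>\<^sup>+s. ennreal (\<kappa> / fact r) * (ennreal (s powr (Q - 1) * (- ln s) ^ r) * indicator {0<..<1} s) \<partial>lborel)"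
  proof (rule nn_integral_cong_AE)
    show "AE s in lborel. ennreal (\<kappa> * (s powr (q - 1) * (- ln s) ^ r / fact r)) *
        ennreal ((s powr \<beta>) ^ m * (s powr \<gamma>) ^ n) * indicator {0..1} s =
        ennreal (\<kappa> / fact r) * (ennreal (s powr (Q - 1) * (- ln s) ^ r) * indicator {0<..<1} s)"
      using AE_lborel_singleton[of "0::real"] AE_lborel_singleton[of "1::real"]
    proof eventually_elim
      fix s :: real assume s: "s \<noteq> 0" "s \<noteq> 1"
      show "ennreal (\<kappa> * (s powr (q - 1) * (- ln s) ^ r / fact r)) *
        ennreal ((s powr \<beta>) ^ m * (s powr \<gamma>) ^ n) * indicator {0..1} s =
        ennreal (\<kappa> / fact r) * (ennreal (s powr (Q - 1) * (- ln s) ^ r) * indicator {0<..<1} s)"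
      proof (cases "s \<in> {0<..<1}")
        case True
        then have "(s powr \<beta>) ^ m * (s powr \<gamma>) ^ n * s powr (q - 1) = s powr (Q - 1)"
          unfolding Q_def by (simp add: powr_power powr_add[symmetric] algebra_simps)
        then have "\<kappa> * (s powr (q - 1) * (- ln s) ^ r / fact r) * ((s powr \<beta>) ^ m * (s powr \<gamma>) ^ n)
          = \<kappa> / fact r * (s powr (Q - 1) * (- ln s) ^ r)"
          by (simp flip: \<open>_ = s powr (Q - 1)\<close>)
        then show ?thesis using True assms by (simp flip: ennreal_mult)
      next
        case False
        then show ?thesis using s by (auto simp: indicator_def)
      qed
    qed
  qed
  also have "\<dots> = ennreal (\<kappa> / fact r) * ennreal (fact r / Q ^ Suc r)"
    by (subst nn_integral_cmult) (auto simp: nn_integral_log_power[OF Q])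
  also have "\<dots> = ennreal (\<kappa> / Q ^ Suc r)" using assms Q by (simp flip: ennreal_mult)
  finally show ?thesis unfolding Q_def .
qed

text \<open>Nonnegative extended integrals give the moments before integrability is known; the
  moment \<open>m = n = 0\<close> yields finiteness of the measure.\<close>

lemma is_representing_measureI:
  assumes sets: "sets \<mu> = sets (restrict_space borel unit_square)"
    and moments: "\<And>m n. (\<integral>\<^sup>+z. ennreal (fst z ^ m * snd z ^ n) \<partial>\<mu>) = ennreal (u m n)"
    and u: "\<And>m n. u m n \<ge> 0"
  shows "is_representing_measure u \<mu>"
  unfolding is_representing_measure_def
proof (intro conjI allI)
  have space: "space \<mu> = unit_square"
    using sets_eq_imp_space_eq[OF sets] by (simp add: space_restrict_space)
  show "finite_measure \<mu>"
    using moments[of 0 0] by (intro finite_measureI) auto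
  fix m n
  have "(\<integral>z. fst z ^ m * snd z ^ n \<partial>\<mu>) = enn2real (\<integral>\<^sup>+z. ennreal (fst z ^ m * snd z ^ n) \<partial>\<mu>)"
  proof (rule integral_eq_nn_integral)
    show "(\<lambda>z. fst z ^ m * snd z ^ n) \<in> borel_measurable \<mu>"
      unfolding measurable_cong_sets[OF sets refl]
      by (intro measurable_restrict_space1) (simp add: borel_prod[symmetric])
    show "AE z in \<mu>. 0 \<le> fst z ^ m * snd z ^ n" using space by (intro AE_I2) auto
  qed
  then show "u m n = (\<integral>(s, t). s ^ m * t ^ n \<partial>\<mu>)"
    using moments[of m n] u by (simp add: case_prod_beta')
qed fact

section \<open>Bessel densities\<close>

text \<open>The entire function left after \<open>(z / 2) ^ r\<close> is split off from the Bessel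
  function and \<open>z\<^sup>2 / 4\<close> is taken as variable. Unlike the displayed density, it
  makes sense at \<open>M = 0\<close>.\<close>

definition bessel_series :: "nat \<Rightarrow> real \<Rightarrow> real" where
  "bessel_series r z = (\<Sum>k. 1 / (fact k * fact (r + k)) * z ^ k)"

lemma summable_bessel_series: "summable (\<lambda>k. 1 / (fact k * fact (r + k)) * z ^ k :: real)"
proof (rule summable_comparison_test)
  have "norm (1 / (fact k * fact (r + k)) * z ^ k) \<le> inverse (fact k) * \<bar>z\<bar> ^ k" for k
  proof -
    have "1 \<le> (fact (r + k) :: real)" by simp
    then have "1 / (fact k * fact (r + k)) \<le> (1 / fact k :: real)"
      by (intro divide_left_mono) auto
    then have "1 / (fact k * fact (r + k)) * \<bar>z\<bar> ^ k \<le> 1 / fact k * \<bar>z\<bar> ^ k"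
      by (rule mult_right_mono) simp
    then show ?thesis by (simp add: abs_mult power_abs inverse_eq_divide)
  qed
  then show "\<exists>N. \<forall>k\<ge>N. norm (1 / (fact k * fact (r + k)) * z ^ k) \<le> inverse (fact k) * \<bar>z\<bar> ^ k"
    by blast
qed (rule summable_exp)

lemma bessel_series_0: "bessel_series r 0 = 1 / fact r"
  unfolding bessel_series_def by (subst powser_zero) simp

lemma isCont_bessel_series: "isCont (bessel_series r) z"
  unfolding bessel_series_def[abs_def]
  by (rule isCont_powser_converges_everywhere[OF summable_bessel_series])

lemma bessel_I_nat:
  assumes "z > 0"
  shows "bessel_I (real r) z = (z / 2) ^ r * bessel_series r (z\<^sup>2 / 4)"
proof -
  have "(if real r = 0 then 1 else (z / 2) powr real r) = (z / 2) ^ r"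
    using assms by (cases "r = 0") (auto simp: powr_realpow)
  moreover have "(z\<^sup>2 / 4) ^ k * (1 / (fact k * Gamma (real r + real k + 1))) =
    1 / (fact k * fact (r + k)) * (z\<^sup>2 / 4) ^ k" for k
    using Gamma_fact[of "r + k", where ?'a = real] by (simp add: add_ac)
  ultimately show ?thesis unfolding bessel_I_def bessel_series_def by (simp only:)
qed

text \<open>One formula for both branches of \<open>weight\<close>: at \<open>M = 0\<close> the
  series contributes \<open>1 / fact r\<close>, and for \<open>M > 0\<close> the square roots of
  \<open>L / M\<close> and \<open>M * L\<close> multiply to \<open>L\<close>.\<close>

lemma weight_bessel_series:
  assumes "d > 0" "M \<ge> 0" "s \<in> {0<..<1}" "t \<in> {0<..<1}"
  shows "weight b c d M (Suc r) s t = s powr (c / d - 1) * t powr (b / d - 1) / (d ^ Suc r * fact r)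
    * (ln s * ln t) ^ r * bessel_series r (M * (ln s * ln t) / d\<^sup>2)"
proof (cases "M = 0")
  case True
  then show ?thesis by (simp add: weight_def bessel_series_0 mult.commute)
next
  case False
  with assms have M: "M > 0" by simp
  define L where "L = ln s * ln t"
  have L: "L > 0" using assms unfolding L_def by (intro mult_neg_neg) auto
  have "(L / M) powr (real r / 2) = sqrt (L / M) ^ r"
    using L M by (simp add: powr_half_sqrt[symmetric] powr_powr powr_realpow[symmetric])
  moreover have "bessel_I (real r) (2 / d * sqrt (M * L)) =
    (sqrt (M * L) / d) ^ r * bessel_series r (M * L / d\<^sup>2)"
  proof -
    have "2 / d * sqrt (M * L) > 0" using L M assms by simp
    from bessel_I_nat[OF this] show ?thesis
      using L M by (simp add: power_mult_distrib power_divide)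
  qed
  moreover have "sqrt (L / M) ^ r * (sqrt (M * L) / d) ^ r = L ^ r / d ^ r"
  proof -
    have "sqrt (L / M) * sqrt (M * L) = L" using L M by (simp flip: real_sqrt_mult add: power2_eq_square[symmetric])
    then show ?thesis by (simp flip: power_mult_distrib power_divide)
  qed
  ultimately have *: "(L / M) powr (real r / 2) * bessel_I (real r) (2 / d * sqrt (M * L))
    = L ^ r / d ^ r * bessel_series r (M * L / d\<^sup>2)" by (metis mult.assoc)
  have "weight b c d M (Suc r) s t = s powr (c / d - 1) * t powr (b / d - 1) / (d * fact r) *
    ((L / M) powr (real r / 2) * bessel_I (real r) (2 / d * sqrt (M * L)))"
    using M by (simp add: weight_def L_def mult.commute mult.left_commute)
  then show ?thesis unfolding * L_def[symmetric] by (simp add: mult_ac)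
qed

text \<open>For \<open>M \<ge> 0\<close> the weight is a function of \<open>M\<close> that is
  continuous at 0, by the common formula with \<open>bessel_series\<close>.\<close>

lemma weight_tendsto:
  assumes "d > 0" "s \<in> {0<..<1}" "t \<in> {0<..<1}"
  shows "((\<lambda>M. weight b c d M (Suc r) s t) \<longlongrightarrow> weight b c d 0 (Suc r) s t) (at_right 0)"
proof -
  let ?W = "\<lambda>M. s powr (c / d - 1) * t powr (b / d - 1) / (d ^ Suc r * fact r)
    * (ln s * ln t) ^ r * bessel_series r (M * (ln s * ln t) / d\<^sup>2)"
  have "isCont ?W 0"
    using assms by (intro continuous_intros isCont_o2[OF _ isCont_bessel_series]) auto
  then have lim: "(?W \<longlongrightarrow> ?W 0) (at_right 0)"
    unfolding isCont_def filterlim_at_split by simp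
  have ev: "eventually (\<lambda>M. ?W M = weight b c d M (Suc r) s t) (at_right 0)"
    using eventually_at_right_less[of 0]
    by eventually_elim (use assms in \<open>simp only: weight_bessel_series less_imp_le\<close>)
  have W0: "?W 0 = weight b c d 0 (Suc r) s t"
    using assms by (simp only: weight_bessel_series order_refl)
  show ?thesis using Lim_transform_eventually[OF lim ev] unfolding W0 .
qed

text \<open>Newton's binomial series with exponent \<open>- (r + 1)\<close>; it sums the moments of
  the Bessel density.\<close>

lemma negative_binomial_sums:
  fixes z :: real
  assumes "\<bar>z\<bar> < 1"
  shows "(\<lambda>k. fact (r + k) / (fact r * fact k) * z ^ k) sums (1 / (1 - z) ^ Suc r)"
proof -
  have "(- real (Suc r) gchoose k) * (- z) ^ k = fact (r + k) / (fact r * fact k) * z ^ k" for k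
  proof -
    have "(- real (Suc r) gchoose k) = (-1) ^ k * (real (r + k) gchoose k)"
      unfolding gbinomial_minus by simp
    also have "(real (r + k) gchoose k) = fact (r + k) / (fact k * fact r)"
      using binomial_fact[of k "r + k", where ?'a = real] unfolding binomial_gbinomial by simp
    finally show ?thesis by (simp add: power_minus[of z] mult_ac flip: power_add mult.assoc)
  qed
  moreover have "(1 + - z) powr (- real (Suc r)) = 1 / (1 - z) ^ Suc r"
    using assms by (simp add: powr_minus_divide powr_realpow del: of_nat_Suc)
  ultimately show ?thesis
    using gen_binomial_real[of "- z" "- real (Suc r)"] assms by simp
qed

text \<open>By Fubini the boundary of the square is null, as 0 and 1 are null on each axis; the set
  identity supplies measurability.\<close>

lemma AE_lborel_open_square:
  "AE z in lborel. z \<in> {0..1} \<times> {0..1} \<longrightarrow> z \<in> {0<..<1::real} \<times> {0<..<1::real}"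
proof -
  have "AE z in lborel \<Otimes>\<^sub>M lborel. z \<in> {0..1} \<times> {0..1} \<longrightarrow> z \<in> {0<..<1::real} \<times> {0<..<1::real}"
  proof (rule lborel_pair.AE_pair_measure)
    have "{z \<in> space (lborel \<Otimes>\<^sub>M lborel). z \<in> {0..1} \<times> {0..1} \<longrightarrow> z \<in> {0<..<1::real} \<times> {0<..<1::real}}
      = - ({0..1} \<times> {0..1}) \<union> {0<..<1} \<times> {0<..<1}"
      by (auto simp: space_pair_measure)
    also have "\<dots> \<in> sets (borel \<Otimes>\<^sub>M borel)"
      unfolding borel_prod by (intro sets.Un borel_open borel_closed[THEN borel_comp] open_Times closed_Times) auto
    finally show "{z \<in> space (lborel \<Otimes>\<^sub>M lborel). z \<in> {0..1} \<times> {0..1} \<longrightarrow> z \<in> {0<..<1::real} \<times> {0<..<1::real}}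
      \<in> sets (lborel \<Otimes>\<^sub>M lborel)"
      by (simp cong: sets_pair_measure_cong)
    have 1: "AE x in lborel. x \<noteq> (0::real) \<and> x \<noteq> 1"
      using AE_lborel_singleton[of "0::real"] AE_lborel_singleton[of "1::real"] by eventually_elim auto
    show "AE x in lborel. AE y in lborel. (x, y) \<in> {0..1} \<times> {0..1} \<longrightarrow> (x, y) \<in> {0<..<1::real} \<times> {0<..<1::real}"
      using 1
    proof eventually_elim
      fix x :: real assume x: "x \<noteq> 0 \<and> x \<noteq> 1"
      show "AE y in lborel. (x, y) \<in> {0..1} \<times> {0..1} \<longrightarrow> (x, y) \<in> {0<..<1::real} \<times> {0<..<1::real}"
        using 1 by eventually_elim (use x in auto)
    qed
  qed
  then show ?thesis unfolding lborel_prod .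
qed

lemma nn_integral_lborel_times:
  fixes f g :: "real \<Rightarrow> ennreal"
  assumes [measurable]: "f \<in> borel_measurable borel" "g \<in> borel_measurable borel"
  shows "(\<integral>\<^sup>+z. f (fst z) * g (snd z) \<partial>lborel) = (\<integral>\<^sup>+x. f x \<partial>lborel) * (\<integral>\<^sup>+x. g x \<partial>lborel)"
proof -
  have "(\<integral>\<^sup>+z. f (fst z) * g (snd z) \<partial>lborel) = (\<integral>\<^sup>+x. \<integral>\<^sup>+y. f x * g y \<partial>lborel \<partial>lborel)"
  proof -
    have "(\<lambda>z. f (fst z) * g (snd z)) \<in> borel_measurable (lborel \<Otimes>\<^sub>M lborel)" by measurable
    from lborel.nn_integral_fst[OF this] show ?thesis by (simp only: lborel_prod fst_conv snd_conv)
  qed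
  also have "\<dots> = (\<integral>\<^sup>+x. f x * (\<integral>\<^sup>+y. g y \<partial>lborel) \<partial>lborel)"
    by (simp add: nn_integral_cmult)
  also have "\<dots> = (\<integral>\<^sup>+x. f x \<partial>lborel) * (\<integral>\<^sup>+x. g x \<partial>lborel)"
    by (simp add: nn_integral_multc)
  finally show ?thesis .
qed

lemma bessel_I_measurable [measurable]: "bessel_I \<nu> \<in> borel_measurable borel"
  unfolding bessel_I_def[abs_def] by measurable

lemma weight_measurable [measurable]:
  "(\<lambda>z. weight b c d M l (fst z) (snd z)) \<in> borel_measurable borel"
  unfolding weight_def borel_prod[symmetric] by measurable

text \<open>All terms of the series are nonnegative, so it may be integrated term by term; each term
  splits into two Gamma integrals. The hypothesis \<open>p\<close> guarantees convergence of the
  resulting binomial series.\<close>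

lemma weighted_measure_moments:
  fixes b c d M :: real
  assumes d: "d > 0" and M: "M \<ge> 0" and bc: "b > 0" "c > 0"
    and p: "d * ((c / d + m) * (b / d + n)) - M / d > 0"
  shows "(\<integral>\<^sup>+z. ennreal (fst z ^ m * snd z ^ n) \<partial>weighted_measure b c d M (Suc r))
    = ennreal (1 / (d * ((c / d + m) * (b / d + n)) - M / d) ^ Suc r)"
proof -
  define X Y where "X = c / d + real m" and "Y = b / d + real n"
  have XY: "X > 0" "Y > 0" using d bc by (auto simp: X_def Y_def add_pos_nonneg)
  \<comment> \<open>\<open>C k\<close> contains \<open>1 / fact (r + k)\<close> once, while the two
    integrals give \<open>fact (r + k)\<close> twice; the quotient is the coefficient of the
    negative binomial series.\<close>
  define C where "C k = (M / d\<^sup>2) ^ k / (d ^ Suc r * fact r * fact k * fact (r + k))" for k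
  define h where "h q k s = ennreal (s powr (q - 1) * (- ln s) ^ (r + k)) * indicator {0<..<1} s" for q k and s :: real
  have [measurable]: "h q k \<in> borel_measurable borel" for q k unfolding h_def by measurable
  have C: "C k \<ge> 0" for k using d M by (simp add: C_def)
  have "(\<integral>\<^sup>+z. ennreal (fst z ^ m * snd z ^ n) \<partial>weighted_measure b c d M (Suc r)) =
    (\<integral>\<^sup>+z. ennreal (weight b c d M (Suc r) (fst z) (snd z)) * ennreal (fst z ^ m * snd z ^ n)
      * indicator unit_square z \<partial>lborel)"
    unfolding weighted_measure_def case_prod_beta'
  proof (subst nn_integral_density)
    show "(\<lambda>z. ennreal (weight b c d M (Suc r) (fst z) (snd z))) \<in> borel_measurable (restrict_space lborel unit_square)"
      by (intro measurable_restrict_space1) simp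
    show "(\<lambda>z. ennreal (fst z ^ m * snd z ^ n)) \<in> borel_measurable (restrict_space lborel unit_square)"
      by (intro measurable_restrict_space1) (simp add: borel_prod[symmetric])
  qed (subst nn_integral_restrict_space; simp add: closed_Times)
  also have "\<dots> = (\<integral>\<^sup>+z. (\<Sum>k. ennreal (C k) * (h X k (fst z) * h Y k (snd z))) \<partial>lborel)"
  proof (rule nn_integral_cong_AE)
    show "AE z in lborel. ennreal (weight b c d M (Suc r) (fst z) (snd z)) * ennreal (fst z ^ m * snd z ^ n)
      * indicator unit_square z = (\<Sum>k. ennreal (C k) * (h X k (fst z) * h Y k (snd z)))"
      using AE_lborel_open_square
    proof eventually_elim
      fix z :: "real \<times> real" assume z: "z \<in> {0..1} \<times> {0..1} \<longrightarrow> z \<in> {0<..<1} \<times> {0<..<1}"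
      obtain s t where st: "z = (s, t)" by (cases z)
      show "ennreal (weight b c d M (Suc r) (fst z) (snd z)) * ennreal (fst z ^ m * snd z ^ n)
        * indicator unit_square z = (\<Sum>k. ennreal (C k) * (h X k (fst z) * h Y k (snd z)))"
      proof (cases "z \<in> unit_square")
        case False
        then show ?thesis by (auto simp: st h_def indicator_def)
      next
        case True
        with z st have s: "s \<in> {0<..<1}" and t: "t \<in> {0<..<1}" by auto
        define L where "L = ln s * ln t"
        \<comment> \<open>Both logarithms are negative, so this form has positive factors, as in
          \<open>h\<close>.\<close>
        have L: "L = (- ln s) * (- ln t)" by (simp add: L_def)
        define P where "P = s powr (X - 1) * t powr (Y - 1)"
        have P: "s powr (c / d - 1) * t powr (b / d - 1) * (s ^ m * t ^ n) = P"
          using s t by (simp add: P_def X_def Y_def powr_realpow[symmetric] powr_add[symmetric] algebra_simps)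
        have "(\<lambda>k. P / (d ^ Suc r * fact r) * L ^ r * (1 / (fact k * fact (r + k)) * (M * L / d\<^sup>2) ^ k)) sums
          (P / (d ^ Suc r * fact r) * L ^ r * bessel_series r (M * L / d\<^sup>2))"
          unfolding bessel_series_def by (intro sums_mult summable_sums summable_bessel_series)
        also have "(\<lambda>k. P / (d ^ Suc r * fact r) * L ^ r * (1 / (fact k * fact (r + k)) * (M * L / d\<^sup>2) ^ k)) =
          (\<lambda>k. C k * (s powr (X - 1) * (- ln s) ^ (r + k) * (t powr (Y - 1) * (- ln t) ^ (r + k))))"
        proof -
          have "P / (d ^ Suc r * fact r) * (u * v) ^ r * (1 / (fact k * fact (r + k)) * (M * (u * v) / d\<^sup>2) ^ k) =
            C k * (s powr (X - 1) * u ^ (r + k) * (t powr (Y - 1) * v ^ (r + k)))" for k u v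
            by (simp add: C_def P_def power_mult_distrib power_add power_divide mult_ac)
          then show ?thesis unfolding L by (simp only:)
        qed
        also have "P / (d ^ Suc r * fact r) * L ^ r * bessel_series r (M * L / d\<^sup>2) =
          weight b c d M (Suc r) s t * (s ^ m * t ^ n)"
          unfolding weight_bessel_series[OF d M s t] L_def[symmetric] P[symmetric] by simp
        finally have sums: "(\<lambda>k. C k * (s powr (X - 1) * (- ln s) ^ (r + k) * (t powr (Y - 1) * (- ln t) ^ (r + k))))
          sums (weight b c d M (Suc r) s t * (s ^ m * t ^ n))" .
        have nonneg: "0 \<le> C k * (s powr (X - 1) * (- ln s) ^ (r + k) * (t powr (Y - 1) * (- ln t) ^ (r + k)))" for k
          using s t by (intro mult_nonneg_nonneg C zero_le_power) auto
        have "ennreal (weight b c d M (Suc r) s t) * ennreal (s ^ m * t ^ n) =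
          ennreal (weight b c d M (Suc r) s t * (s ^ m * t ^ n))"
          using s t by (intro ennreal_mult''[symmetric]) auto
        also have "\<dots> = (\<Sum>k. ennreal (C k * (s powr (X - 1) * (- ln s) ^ (r + k) * (t powr (Y - 1) * (- ln t) ^ (r + k)))))"
          by (rule suminf_ennreal_eq[OF nonneg sums, symmetric])
        also have "\<dots> = (\<Sum>k. ennreal (C k) * (h X k s * h Y k t))"
          using s t C unfolding h_def by (simp add: ennreal_mult)
        finally show ?thesis using True st by simp
      qed
    qed
  qed
  also have "\<dots> = (\<Sum>k. \<integral>\<^sup>+z. ennreal (C k) * (h X k (fst z) * h Y k (snd z)) \<partial>lborel)"
    by (rule nn_integral_suminf) (simp add: borel_prod[symmetric])
  also have "\<dots> = (\<Sum>k. ennreal (C k * (fact (r + k) / X ^ Suc (r + k) * (fact (r + k) / Y ^ Suc (r + k)))))"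
  proof (rule suminf_cong)
    fix k
    have "(\<integral>\<^sup>+z. ennreal (C k) * (h X k (fst z) * h Y k (snd z)) \<partial>lborel) =
      ennreal (C k) * ((\<integral>\<^sup>+s. h X k s \<partial>lborel) * (\<integral>\<^sup>+t. h Y k t \<partial>lborel))"
      by (subst nn_integral_cmult) (auto simp: nn_integral_lborel_times borel_prod[symmetric])
    also have "\<dots> = ennreal (C k) * (ennreal (fact (r + k) / X ^ Suc (r + k)) * ennreal (fact (r + k) / Y ^ Suc (r + k)))"
      unfolding h_def nn_integral_log_power[OF XY(1)] nn_integral_log_power[OF XY(2)] ..
    also have "\<dots> = ennreal (C k * (fact (r + k) / X ^ Suc (r + k) * (fact (r + k) / Y ^ Suc (r + k))))"
      using XY C by (simp flip: ennreal_mult)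
    finally show "(\<integral>\<^sup>+z. ennreal (C k) * (h X k (fst z) * h Y k (snd z)) \<partial>lborel) =
      ennreal (C k * (fact (r + k) / X ^ Suc (r + k) * (fact (r + k) / Y ^ Suc (r + k))))" .
  qed
  also have "\<dots> = ennreal (1 / (d * (X * Y) - M / d) ^ Suc r)"
  proof (rule suminf_ennreal_eq)
    \<comment> \<open>Factoring \<open>d * (X * Y)\<close> out of the polynomial leaves
      \<open>1 - z\<close>, so its positivity says exactly that \<open>z < 1\<close>.\<close>
    define z where "z = M / (d\<^sup>2 * (X * Y))"
    have z0: "z \<ge> 0" using M d XY by (simp add: z_def)
    have p': "d * (X * Y) - M / d = d * (X * Y) * (1 - z)"
      using d XY by (simp add: z_def field_simps power2_eq_square)
    have z1: "z < 1"
    proof -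
      have "d * (X * Y) * (1 - z) > 0" using p unfolding X_def[symmetric] Y_def[symmetric] p' .
      moreover have "d * (X * Y) > 0" using d XY by simp
      ultimately show ?thesis using zero_less_mult_pos by fastforce
    qed
    have "(\<lambda>k. 1 / (d * (X * Y)) ^ Suc r * (fact (r + k) / (fact r * fact k) * z ^ k)) sums
      (1 / (d * (X * Y)) ^ Suc r * (1 / (1 - z) ^ Suc r))"
      using z0 z1 by (intro sums_mult negative_binomial_sums) simp
    moreover have "1 / (d * (X * Y)) ^ Suc r * (1 / (1 - z) ^ Suc r) = 1 / (d * (X * Y) - M / d) ^ Suc r"
      unfolding p' power_mult_distrib by simp
    moreover have "1 / (d * (X * Y)) ^ Suc r * (fact (r + k) / (fact r * fact k) * z ^ k) =
      C k * (fact (r + k) / X ^ Suc (r + k) * (fact (r + k) / Y ^ Suc (r + k)))" for k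
    proof -
      have "C k * (fact (r + k) / X ^ Suc (r + k) * (fact (r + k) / Y ^ Suc (r + k)))
        = (M / d\<^sup>2) ^ k / (d ^ Suc r * fact r * fact k) * fact (r + k) / (X ^ Suc (r + k) * Y ^ Suc (r + k))"
        unfolding C_def by simp
      also have "\<dots> = fact (r + k) / (fact r * fact k) * (1 / (d * (X * Y)) ^ Suc r) * (M / d\<^sup>2 / (X * Y)) ^ k"
        by (simp add: power_mult_distrib power_divide power_add mult_ac)
      also have "M / d\<^sup>2 / (X * Y) = z" by (simp add: z_def)
      finally show ?thesis by simp
    qed
    ultimately show "(\<lambda>k. C k * (fact (r + k) / X ^ Suc (r + k) * (fact (r + k) / Y ^ Suc (r + k)))) sums
      (1 / (d * (X * Y) - M / d) ^ Suc r)" by simp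
    show "0 \<le> C k * (fact (r + k) / X ^ Suc (r + k) * (fact (r + k) / Y ^ Suc (r + k)))" for k
      using C XY by simp
  qed
  finally show ?thesis unfolding X_def Y_def .
qed

section \<open>Representing measures of the powers\<close>

text \<open>The moment lemmas apply to the two coordinate projections; \<open>pos\<close> excludes
  mass on the axes, which is what minimality needs.\<close>

lemma is_representing_measure_joint_cm_minimal:
  assumes "is_representing_measure u \<mu>" and pos: "AE z in \<mu>. 0 < fst z \<and> 0 < snd z"
  shows "joint_cm_net u" "minimal_net u"
proof -
  have fin: "finite_measure \<mu>" and sets: "sets \<mu> = sets (restrict_space borel unit_square)"
    and u: "u m n = (\<integral>z. fst z ^ m * snd z ^ n \<partial>\<mu>)" for m n
    using assms(1) unfolding is_representing_measure_def case_prod_beta' by auto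
  interpret finite_measure \<mu> by fact
  have "space \<mu> = unit_square"
    using sets_eq_imp_space_eq[OF sets] by (simp add: space_restrict_space)
  then have AE: "AE z in \<mu>. 0 \<le> fst z \<and> fst z \<le> 1" "AE z in \<mu>. 0 \<le> snd z \<and> snd z \<le> 1"
    by (auto intro!: AE_I2)
  have AE': "AE z in \<mu>. 0 < fst z \<and> fst z \<le> 1" "AE z in \<mu>. 0 < snd z \<and> snd z \<le> 1"
    using pos AE by (auto elim: AE_mp intro!: AE_I2)
  have [measurable]: "fst \<in> borel_measurable \<mu>" "snd \<in> borel_measurable \<mu>"
    unfolding measurable_cong_sets[OF sets refl]
    by (intro measurable_restrict_space1; simp add: borel_prod[symmetric])+
  show "joint_cm_net u" by (rule joint_cm_net_moments[OF _ _ AE u]) measurable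
  show "minimal_net u" by (rule minimal_net_moments[OF _ _ AE' u]) measurable
qed

context bilinear_pos
begin

lemma weighted_measure_represents:
  assumes d: "d \<noteq> 0" and M: "b * c - a * d \<ge> 0"
  shows "is_representing_measure (\<lambda>m n. 1 / (a + b * real m + c * real n + d * real m * real n) ^ Suc r)
    (weighted_measure b c d (b * c - a * d) (Suc r))"
proof (rule is_representing_measureI)
  have dpos: "d > 0" using d d_nonneg by simp
  \<comment> \<open>From \<open>b * c \<ge> a * d > 0\<close> both exponents \<open>c / d\<close>
    and \<open>b / d\<close> are positive, so the density is integrable near the axes.\<close>
  then have "b * c > 0" using M mult_pos_pos[OF a_pos dpos] by linarith
  then have bc: "b > 0" "c > 0" using b_nonneg c_nonneg by (auto simp: zero_less_mult_iff)
  show "sets (weighted_measure b c d (b * c - a * d) (Suc r)) = sets (restrict_space borel unit_square)"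
    by (simp add: weighted_measure_def sets_restrict_space)
  fix m n :: nat
  have p: "d * ((c / d + m) * (b / d + n)) - (b * c - a * d) / d = a + b * m + c * n + d * m * n"
    using dpos by (simp add: field_simps)
  have "a + b * m + c * n + d * m * n > 0" using pos[of m n] by simp
  then show "0 \<le> 1 / (a + b * real m + c * real n + d * real m * real n) ^ Suc r" by simp
  show "(\<integral>\<^sup>+z. ennreal (fst z ^ m * snd z ^ n) \<partial>weighted_measure b c d (b * c - a * d) (Suc r)) =
    ennreal (1 / (a + b * real m + c * real n + d * real m * real n) ^ Suc r)"
    using weighted_measure_moments[OF dpos M bc, of m n r] pos[of m n] unfolding p by simp
qed

text \<open>The convention \<open>0 powr x = 0\<close> makes the density vanish on both
  axes.\<close>

lemma weighted_measure_AE_pos: "AE z in weighted_measure b c d M l. 0 < fst z \<and> 0 < snd z"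
proof -
  have "(\<lambda>z. ennreal (weight b c d M l (fst z) (snd z))) \<in> borel_measurable (restrict_space lborel unit_square)"
    by (intro measurable_restrict_space1) simp
  moreover have "weight b c d M l s t = 0" if "s = 0 \<or> t = 0" for s t
    using that by (auto simp: weight_def)
  then have "0 < fst z \<and> 0 < snd z" if "z \<in> unit_square" "0 < ennreal (weight b c d M l (fst z) (snd z))" for z
    using that by (cases "fst z = 0 \<or> snd z = 0") (auto simp: mem_Times_iff)
  ultimately show ?thesis
    unfolding weighted_measure_def case_prod_beta'
    by (subst AE_density) (auto intro!: AE_I2 simp: space_restrict_space)
qed

text \<open>Pulled back to the parameter \<open>s\<close>, the moments are those of
  \<open>log_measure\<close> with \<open>\<beta> = 1\<close> and \<open>\<gamma> = c / b\<close>;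
  the factor \<open>1 / b ^ Suc r\<close> turns the denominator into a power of
  \<open>p\<close>.\<close>

lemma curve_measure_represents:
  assumes b: "b \<noteq> 0" and d: "d = 0"
  shows "is_representing_measure (\<lambda>m n. 1 / (a + b * real m + c * real n + d * real m * real n) ^ Suc r)
    (curve_measure a b c (Suc r))"
proof (rule is_representing_measureI)
  show "sets (curve_measure a b c (Suc r)) = sets (restrict_space borel unit_square)"
    by (simp add: curve_measure_def)
  fix m n :: nat
  have bpos: "b > 0" using b b_nonneg by simp
  have "a + b * m + c * n + d * m * n > 0" using pos[of m n] by simp
  then show "0 \<le> 1 / (a + b * real m + c * real n + d * real m * real n) ^ Suc r" by simp
  have sets: "sets (log_measure (1 / b ^ Suc r) (a / b) r) = sets (restrict_space borel {0..1})"
    by (simp add: log_measure_def sets_restrict_space)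
  have "space (log_measure (1 / b ^ Suc r) (a / b) r) = {0..1}"
    using sets_eq_imp_space_eq[OF sets] by (simp add: space_restrict_space)
  note space = this
  \<comment> \<open>The sign in the displayed density is absorbed by \<open>- ln s\<close>.\<close>
  have "(-1) ^ r / (b ^ Suc r * fact r) * ln s ^ r * s powr (a / b - 1) =
    1 / b ^ Suc r * (s powr (a / b - 1) * (- ln s) ^ r / fact r)" for s
    by (simp add: power_minus[of "ln s"])
  then have curve: "curve_measure a b c (Suc r) = distr (log_measure (1 / b ^ Suc r) (a / b) r)
      (restrict_space borel unit_square) (\<lambda>s. (s, s powr (c / b)))"
    unfolding curve_measure_def log_measure_def diff_Suc_1 by (simp only:)
  have meas: "(\<lambda>s. (s, s powr (c / b))) \<in>
    log_measure (1 / b ^ Suc r) (a / b) r \<rightarrow>\<^sub>M restrict_space borel unit_square"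
    unfolding measurable_cong_sets[OF sets refl]
  proof (intro measurable_restrict_space2 measurable_restrict_space1)
    show "(\<lambda>s. (s, s powr (c / b))) \<in> space (restrict_space borel {0..1}) \<rightarrow> unit_square"
      using bpos c_nonneg by (auto simp: space_restrict_space intro!: powr_le1)
    show "(\<lambda>s. (s, s powr (c / b))) \<in> borel \<rightarrow>\<^sub>M borel"
      unfolding borel_prod[symmetric] by measurable
  qed
  have "(\<lambda>z. ennreal (fst z ^ m * snd z ^ n)) \<in> borel_measurable (restrict_space borel unit_square)"
    by (intro measurable_restrict_space1) (simp add: borel_prod[symmetric])
  then have "(\<lambda>z. ennreal (fst z ^ m * snd z ^ n)) \<in> borel_measurable
    (distr (log_measure (1 / b ^ Suc r) (a / b) r) (restrict_space borel unit_square) (\<lambda>s. (s, s powr (c / b))))"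
    by simp
  from nn_integral_distr[OF meas this]
  have "(\<integral>\<^sup>+z. ennreal (fst z ^ m * snd z ^ n) \<partial>curve_measure a b c (Suc r)) =
    (\<integral>\<^sup>+s. ennreal (fst (s, s powr (c / b)) ^ m * snd (s, s powr (c / b)) ^ n) \<partial>log_measure (1 / b ^ Suc r) (a / b) r)"
    unfolding curve .
  also have "\<dots> = (\<integral>\<^sup>+s. ennreal (s ^ m * (s powr (c / b)) ^ n) \<partial>log_measure (1 / b ^ Suc r) (a / b) r)"
    by (simp only: fst_conv snd_conv)
  also have "\<dots> = (\<integral>\<^sup>+s. ennreal ((s powr 1) ^ m * (s powr (c / b)) ^ n) \<partial>log_measure (1 / b ^ Suc r) (a / b) r)"
    by (intro nn_integral_cong, unfold space) simp
  also have "\<dots> = ennreal (1 / b ^ Suc r / (a / b + 1 * real m + c / b * real n) ^ Suc r)"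
    using bpos a_pos c_nonneg by (intro log_measure_moments) auto
  also have "1 / b ^ Suc r / (a / b + 1 * real m + c / b * real n) ^ Suc r = 1 / (b * (a / b + 1 * real m + c / b * real n)) ^ Suc r"
    by (simp add: power_mult_distrib)
  also have "b * (a / b + 1 * real m + c / b * real n) = a + b * real m + c * real n + d * real m * real n"
    using bpos d by (simp add: field_simps)
  finally show "(\<integral>\<^sup>+z. ennreal (fst z ^ m * snd z ^ n) \<partial>curve_measure a b c (Suc r)) =
    ennreal (1 / (a + b * real m + c * real n + d * real m * real n) ^ Suc r)" .
qed

text \<open>The curve \<open>t = s powr (c / b)\<close> requires \<open>b \<noteq> 0\<close>.
  Parametrising by \<open>(s powr b, s powr c)\<close> under a density with exponent
  \<open>a - 1\<close> treats all linear \<open>p\<close> alike, constants included.\<close>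

lemma linear_joint_cm_minimal:
  assumes d: "d = 0"
  shows "joint_cm_net (\<lambda>m n. 1 / (a + b * real m + c * real n + d * real m * real n) ^ Suc r)" (is "joint_cm_net ?u")
    and "minimal_net (\<lambda>m n. 1 / (a + b * real m + c * real n + d * real m * real n) ^ Suc r)"
proof -
  let ?N = "log_measure 1 a r"
  have mom: "(\<integral>\<^sup>+s. ennreal ((s powr b) ^ m * (s powr c) ^ n) \<partial>?N) = ennreal (?u m n)" for m n
    using log_measure_moments[where \<kappa> = 1 and q = a and \<beta> = b and \<gamma> = c and m = m and n = n and r = r] a_pos b_nonneg c_nonneg d by simp
  have sets: "sets ?N = sets (restrict_space borel {0..1})"
    by (simp add: log_measure_def sets_restrict_space)
  have space: "space ?N = {0..1}"
    using sets_eq_imp_space_eq[OF sets] by (simp add: space_restrict_space)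
  interpret finite_measure ?N
    using mom[of 0 0] by (intro finite_measureI) auto
  have meas: "(\<lambda>s. s powr b) \<in> borel_measurable ?N" "(\<lambda>s. s powr c) \<in> borel_measurable ?N"
    unfolding measurable_cong_sets[OF sets refl] by (intro measurable_restrict_space1; measurable)+
  \<comment> \<open>The density is 0 at \<open>s = 0\<close>, again because
    \<open>0 powr x = 0\<close>.\<close>
  have pos: "AE s in ?N. s \<in> {0<..1}"
    unfolding log_measure_def
    by (subst AE_density)
      (auto intro!: AE_I2 measurable_restrict_space1 simp: space_restrict_space less_le)
  have AE': "AE s in ?N. 0 < s powr b \<and> s powr b \<le> 1" "AE s in ?N. 0 < s powr c \<and> s powr c \<le> 1"
    using pos by (eventually_elim, use b_nonneg c_nonneg in \<open>auto intro!: powr_le1\<close>)+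
  have AE: "AE s in ?N. 0 \<le> s powr b \<and> s powr b \<le> 1" "AE s in ?N. 0 \<le> s powr c \<and> s powr c \<le> 1"
    using AE' by (eventually_elim, simp)+
  have u: "?u m n = (\<integral>s. (s powr b) ^ m * (s powr c) ^ n \<partial>?N)" for m n
  proof -
    have "(\<integral>s. (s powr b) ^ m * (s powr c) ^ n \<partial>?N) = enn2real (ennreal (?u m n))"
      unfolding mom[symmetric]
      by (intro integral_eq_nn_integral borel_measurable_times borel_measurable_power meas AE_I2) simp
    moreover have "?u m n \<ge> 0" using bilinear_pos.pos[OF bilinear_pos_axioms, of m n] by simp
    ultimately show ?thesis by simp
  qed
  show "joint_cm_net ?u" by (rule joint_cm_net_moments[OF meas AE u])
  show "minimal_net ?u" by (rule minimal_net_moments[OF meas AE' u])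
qed

lemma joint_cm_minimal:
  assumes M: "b * c - a * d \<ge> 0"
  shows "joint_cm_net (\<lambda>m n. 1 / (a + b * real m + c * real n + d * real m * real n) ^ Suc r)"
    and "minimal_net (\<lambda>m n. 1 / (a + b * real m + c * real n + d * real m * real n) ^ Suc r)"
proof -
  have "joint_cm_net (\<lambda>m n. 1 / (a + b * real m + c * real n + d * real m * real n) ^ Suc r) \<and>
    minimal_net (\<lambda>m n. 1 / (a + b * real m + c * real n + d * real m * real n) ^ Suc r)"
  proof (cases "d = 0")
    case True
    then show ?thesis using linear_joint_cm_minimal by blast
  next
    case False
    show ?thesis
      using is_representing_measure_joint_cm_minimal[OF weighted_measure_represents[OF False M] weighted_measure_AE_pos]
      by blast
  qed
  then show "joint_cm_net (\<lambda>m n. 1 / (a + b * real m + c * real n + d * real m * real n) ^ Suc r)"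
    and "minimal_net (\<lambda>m n. 1 / (a + b * real m + c * real n + d * real m * real n) ^ Suc r)" by auto
qed

end

theorem theorem3p1:
  fixes p :: "real \<Rightarrow> real \<Rightarrow> real" and a b c d M :: real
  assumes p_eq: "\<And>x y. x \<ge> 0 \<Longrightarrow> y \<ge> 0 \<Longrightarrow> p x y = a + b * x + c * y + d * x * y"
    and p_pos: "\<And>x y. x \<ge> 0 \<Longrightarrow> y \<ge> 0 \<Longrightarrow> p x y > 0"
    and M_eq: "M = b * c - a * d"
  shows
    "(joint_cm_function (\<lambda>x y. 1 / p x y) \<longleftrightarrow> M \<ge> 0) \<and>
     (M \<ge> 0 \<longleftrightarrow> joint_cm_net (\<lambda>m n. 1 / p (real m) (real n))) \<and>
     (joint_cm_net (\<lambda>m n. 1 / p (real m) (real n)) \<longleftrightarrow>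
        joint_cm_net (\<lambda>m n. 1 / p (real m) (real n)) \<and>
        minimal_net (\<lambda>m n. 1 / p (real m) (real n))) \<and>
     (M \<ge> 0 \<longrightarrow>
        (\<forall>l\<ge>1.
           joint_cm_net (\<lambda>m n. 1 / p (real m) (real n) ^ l) \<and>
           minimal_net (\<lambda>m n. 1 / p (real m) (real n) ^ l) \<and>
           (d \<noteq> 0 \<longrightarrow>
              is_representing_measure (\<lambda>m n. 1 / p (real m) (real n) ^ l)
                (weighted_measure b c d M l)) \<and>
           (b \<noteq> 0 \<and> d = 0 \<longrightarrow>
              is_representing_measure (\<lambda>m n. 1 / p (real m) (real n) ^ l)
                (curve_measure a b c l)))) \<and>
     (d \<noteq> 0 \<and> M \<ge> 0 \<longrightarrow>
        (\<forall>l\<ge>1. \<forall>s\<in>{0<..<1}. \<forall>t\<in>{0<..<1}.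
           ((\<lambda>M'. weight b c d M' l s t) \<longlongrightarrow> weight b c d 0 l s t) (at_right 0)))"
proof -
  interpret bilinear_pos a b c d
    by unfold_locales (simp add: p_pos flip: p_eq)
  have p_nat: "p (real m) (real n) = a + b * real m + c * real n + d * real m * real n" for m n
    by (simp add: p_eq)
  have F: "\<forall>x\<ge>0. \<forall>y\<ge>0. 1 / p x y = 1 / (a + b * x + c * y + d * x * y)"
    by (simp add: p_eq)
  have fun_iff: "joint_cm_function (\<lambda>x y. 1 / p x y) \<longleftrightarrow> M \<ge> 0"
    using joint_cm_function_if[OF _ F] joint_cm_function_only_if[OF F] unfolding M_eq by blast
  have net: "M \<ge> 0" if "joint_cm_net (\<lambda>m n. 1 / p (real m) (real n))"
    using joint_cm_net_only_if that unfolding M_eq p_nat by blast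
  have powers: "joint_cm_net (\<lambda>m n. 1 / p (real m) (real n) ^ Suc r)"
    "minimal_net (\<lambda>m n. 1 / p (real m) (real n) ^ Suc r)" if "M \<ge> 0" for r
    using joint_cm_minimal that unfolding M_eq p_nat by blast+
  have weighted: "is_representing_measure (\<lambda>m n. 1 / p (real m) (real n) ^ Suc r) (weighted_measure b c d M (Suc r))"
    if "d \<noteq> 0" "M \<ge> 0" for r
    using weighted_measure_represents that unfolding M_eq p_nat by blast
  have curve: "is_representing_measure (\<lambda>m n. 1 / p (real m) (real n) ^ Suc r) (curve_measure a b c (Suc r))"
    if "b \<noteq> 0" "d = 0" for r
    using curve_measure_represents[OF that] unfolding p_nat .
  have limit: "((\<lambda>M'. weight b c d M' (Suc r) s t) \<longlongrightarrow> weight b c d 0 (Suc r) s t) (at_right 0)"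
    if "d \<noteq> 0" "s \<in> {0<..<1}" "t \<in> {0<..<1}" for r s t
    using weight_tendsto that d_nonneg by simp
  have l: "\<exists>r. l = Suc r" if "l \<ge> 1" for l using that by (cases l) auto
  show ?thesis
  proof (intro conjI)
    show "joint_cm_function (\<lambda>x y. 1 / p x y) \<longleftrightarrow> M \<ge> 0" by (rule fun_iff)
    show "M \<ge> 0 \<longleftrightarrow> joint_cm_net (\<lambda>m n. 1 / p (real m) (real n))"
      \<comment> \<open>Index 0 stands for the exponent \<open>l = 1\<close>.\<close>
      using net powers(1)[of 0] by auto
    show "joint_cm_net (\<lambda>m n. 1 / p (real m) (real n)) \<longleftrightarrow>
        joint_cm_net (\<lambda>m n. 1 / p (real m) (real n)) \<and>
        minimal_net (\<lambda>m n. 1 / p (real m) (real n))"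
      using net powers(2)[of 0] by auto
    show "M \<ge> 0 \<longrightarrow> (\<forall>l\<ge>1.
           joint_cm_net (\<lambda>m n. 1 / p (real m) (real n) ^ l) \<and>
           minimal_net (\<lambda>m n. 1 / p (real m) (real n) ^ l) \<and>
           (d \<noteq> 0 \<longrightarrow>
              is_representing_measure (\<lambda>m n. 1 / p (real m) (real n) ^ l)
                (weighted_measure b c d M l)) \<and>
           (b \<noteq> 0 \<and> d = 0 \<longrightarrow>
              is_representing_measure (\<lambda>m n. 1 / p (real m) (real n) ^ l)
                (curve_measure a b c l)))"
    proof (intro allI impI)
      fix l :: nat assume M: "M \<ge> 0" and "l \<ge> 1"
      then obtain r where r: "l = Suc r" using l by blast
      show "joint_cm_net (\<lambda>m n. 1 / p (real m) (real n) ^ l) \<and>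
           minimal_net (\<lambda>m n. 1 / p (real m) (real n) ^ l) \<and>
           (d \<noteq> 0 \<longrightarrow>
              is_representing_measure (\<lambda>m n. 1 / p (real m) (real n) ^ l)
                (weighted_measure b c d M l)) \<and>
           (b \<noteq> 0 \<and> d = 0 \<longrightarrow>
              is_representing_measure (\<lambda>m n. 1 / p (real m) (real n) ^ l)
                (curve_measure a b c l))"
        unfolding r by (intro conjI impI powers weighted curve M) simp_all
    qed
    show "d \<noteq> 0 \<and> M \<ge> 0 \<longrightarrow>
        (\<forall>l\<ge>1. \<forall>s\<in>{0<..<1}. \<forall>t\<in>{0<..<1}.
           ((\<lambda>M'. weight b c d M' l s t) \<longlongrightarrow> weight b c d 0 l s t) (at_right 0))"
    proof (intro allI impI ballI)
      fix l :: nat and s t :: real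
      assume "d \<noteq> 0 \<and> M \<ge> 0" "l \<ge> 1" "s \<in> {0<..<1}" "t \<in> {0<..<1}"
      then show "((\<lambda>M'. weight b c d M' l s t) \<longlongrightarrow> weight b c d 0 l s t) (at_right 0)"
        using limit[of s t "l - 1"] by simp
    qed
  qed
qed

end
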